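(* Fix integers $N>1$, $a\ge 1$, $b\ge 1$ and consider the system of $N$ interacting urns with parameter $\alpha$ described in the context. Let $Z$ denote the almost sure limit of $Z_t$. Let $j\in\{1,\dots,N\}$. (i) If $1/2<\alpha\le 1$, then, as $t\to+\infty$, $$\sqrt{t}\,(Z_t(j)-Z_t)\ \text{ converges stably to }\ \mathcal N\left(0,\ \frac{1-\frac1N}{2\alpha-1}\,(Z-Z^2)\right).$$ (ii) If $\alpha=1/2$, then, as $t\to+\infty$, $$\frac{\sqrt{t}}{\sqrt{\ln(t)}}\,(Z_t(j)-Z_t)\ \text{ converges stably to }\ \mathcal N\left(0,\ \left(1-\frac1N\right)(Z-Z^2)\right).$$ Moreover, these limit Gaussian kernels are not degenerate, i.e. their random variances are not almost surely equal to zero.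
   Context: Model. On a probability space $(\Omega,\mathcal A,P)$ there are $N$ urns. At time $t=0$ each urn contains $a$ red balls and $b$ black balls; set $m=a+b$. At each time $t+1$ ($t\ge 0$) one new ball is added to each urn. Let $I_{t+1}(i)\in\{0,1\}$ be the indicator that the ball added to urn $i$ at time $t+1$ is red, let $Z_t(i)$ be the proportion of red balls in urn $i$ at time $t$, and let $Z_t=\frac1N\sum_{i=1}^N Z_t(i)$. Thus $Z_0(i)=a/m$ and $Z_{t+1}(i)-Z_t(i)=\frac{I_{t+1}(i)-Z_t(i)}{m+t+1}$. Let $\mathcal F_0=\{\Omega,\emptyset\}$ and $\mathcal F_t=\sigma(I_k(i):\ i=1,\dots,N,\ 1\le k\le t)$. Conditionally on $\mathcal F_t$, the variables $I_{t+1}(1),\dots,I_{t+1}(N)$ are independent and $P(I_{t+1}(j)=1\mid\mathcal F_t)=\alpha Z_t+(1-\alpha)Z_t(j)$, where $\alpha\in[0,1]$ is a parameter. The process $(Z_t)$ is a bounded $(\mathcal F_t)$-martingale, so it converges almost surely to a random variable $Z$. Stable convergence. A kernel on $\mathbb R$ is a family $K=\{K(\omega):\omega\in\Omega\}$ of probability measures on the Borel sets of $\mathbb R$ such that $\omega\mapsto K(f)(\omega)=\int f(x)\,K(\omega)(dx)$ is $\mathcal A$-measurable for each bounded Borel $f:\mathbb R\to\mathbb R$. A sequence $(Y_t)$ of real random variables on $(\Omega,\mathcal A,P)$ converges stably to $K$ if, for all $H\in\mathcal A$ with $P(H)>0$, the probability measures $P(Y_t\in\cdot\mid H)$ converge weakly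 to $E[K(\cdot)\mid H]$. For a nonnegative random variable $V$, $\mathcal N(0,V)$ denotes the Gaussian kernel $\omega\mapsto\mathcal N(0,V(\omega))$, where $\mathcal N(0,0)$ is the Dirac mass at $0$. *)

theory Defs
  imports "HOL-Probability.Probability"
begin

section \<open>Conditional probability and conditional independence given a sub-sigma-algebra\<close>

definition prob_given :: "'a measure \<Rightarrow> 'a measure \<Rightarrow> 'a set \<Rightarrow> 'a \<Rightarrow> real" where
  "prob_given M F A = real_cond_exp M F (indicator A)"

text \<open>Conditional analogue of the library's \<open>indep_vars\<close>. Conditional probabilities are defined
  only up to null sets, so the product formula is required almost everywhere, for each choice
  of the sets \<open>B j\<close>.\<close>

definition cond_indep_vars ::
  "'a measure \<Rightarrow> 'a measure \<Rightarrow> 'i set \<Rightarrow> ('i \<Rightarrow> 'a \<Rightarrow> real) \<Rightarrow> bool" where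
  "cond_indep_vars M F S X \<longleftrightarrow>
     (\<forall>i\<in>S. X i \<in> borel_measurable M) \<and>
     (\<forall>J B. J \<subseteq> S \<and> J \<noteq> {} \<and> finite J \<and> (\<forall>j\<in>J. B j \<in> sets borel) \<longrightarrow>
        (AE \<omega> in M. prob_given M F {x \<in> space M. \<forall>j\<in>J. X j x \<in> B j} \<omega>
                     = (\<Prod>j\<in>J. prob_given M F {x \<in> space M. X j x \<in> B j} \<omega>)))"

section \<open>The system of interacting urns\<close>

text \<open>\<open>I t i\<close> is the indicator that the ball added to urn \<open>i\<close> at time \<open>t\<close> is red; only the values
  with \<open>t \<ge> 1\<close> and \<open>i \<in> {1..N}\<close> are relevant.\<close>

definition urn_prop :: "nat \<Rightarrow> nat \<Rightarrow> (nat \<Rightarrow> nat \<Rightarrow> 'a \<Rightarrow> real) \<Rightarrow> nat \<Rightarrow> nat \<Rightarrow> 'a \<Rightarrow> real" where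
  "urn_prop a b I t i \<omega> = (real a + (\<Sum>k=1..t. I k i \<omega>)) / real (a + b + t)"

definition urn_mean ::
  "nat \<Rightarrow> nat \<Rightarrow> nat \<Rightarrow> (nat \<Rightarrow> nat \<Rightarrow> 'a \<Rightarrow> real) \<Rightarrow> nat \<Rightarrow> 'a \<Rightarrow> real" where
  "urn_mean N a b I t \<omega> = (1 / real N) * (\<Sum>i=1..N. urn_prop a b I t i \<omega>)"

definition urn_filtration ::
  "'a measure \<Rightarrow> nat \<Rightarrow> (nat \<Rightarrow> nat \<Rightarrow> 'a \<Rightarrow> real) \<Rightarrow> nat \<Rightarrow> 'a measure" where
  "urn_filtration M N I t =
     sigma (space M) {I k i -` B \<inter> space M | k i B. k \<in> {1..t} \<and> i \<in> {1..N} \<and> B \<in> sets borel}"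

locale interacting_urns = prob_space M
  for M :: "'a measure" +
  fixes N a b :: nat and \<alpha> :: real and I :: "nat \<Rightarrow> nat \<Rightarrow> 'a \<Rightarrow> real"
  assumes alpha: "0 \<le> \<alpha>" "\<alpha> \<le> 1"
    and I_measurable: "\<And>t i. 1 \<le> t \<Longrightarrow> i \<in> {1..N} \<Longrightarrow> I t i \<in> borel_measurable M"
    and I_indicator: "\<And>t i \<omega>. 1 \<le> t \<Longrightarrow> i \<in> {1..N} \<Longrightarrow> \<omega> \<in> space M \<Longrightarrow> I t i \<omega> \<in> {0, 1}"
    and cond_indep: "\<And>t. cond_indep_vars M (urn_filtration M N I t) {1..N} (I (Suc t))"
    and cond_law: "\<And>t j. j \<in> {1..N} \<Longrightarrow>
      AE \<omega> in M. prob_given M (urn_filtration M N I t) {x \<in> space M. I (Suc t) j x = 1} \<omega>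
                  = \<alpha> * urn_mean N a b I t \<omega> + (1 - \<alpha>) * urn_prop a b I t j \<omega>"

lemma urn_prop_0: "urn_prop a b I 0 i \<omega> = real a / real (a + b)"
  by (simp add: urn_prop_def)

lemma urn_prop_Suc:
  assumes "a + b > 0"
  shows "urn_prop a b I (Suc t) i \<omega> - urn_prop a b I t i \<omega>
    = (I (Suc t) i \<omega> - urn_prop a b I t i \<omega>) / real (a + b + t + 1)"
proof -
  have "real (a + b + t) > 0" "real (a + b + t + 1) > 0" using assms by linarith+
  then show ?thesis
    unfolding urn_prop_def by (simp add: field_simps)
qed

lemma sets_urn_filtration_0: "sets (urn_filtration M N I 0) = {{}, space M}"
  by (simp add: urn_filtration_def sigma_sets_empty_eq)

lemma (in interacting_urns) subalgebra_urn_filtration: "subalgebra M (urn_filtration M N I t)"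
proof -
  let ?G = "{I k i -` B \<inter> space M | k i B. k \<in> {1..t} \<and> i \<in> {1..N} \<and> B \<in> sets borel}"
  have "?G \<subseteq> sets M"
    using I_measurable by (auto intro: measurable_sets)
  moreover have "?G \<subseteq> Pow (space M)" by auto
  ultimately show ?thesis
    by (simp add: subalgebra_def urn_filtration_def sets.sigma_sets_subset)
qed

section \<open>Kernels and stable convergence\<close>

text \<open>A kernel is a measurable map into the library's space of probability measures on \<open>borel\<close>;
  the next lemma relates this to measurability of \<open>\<omega> \<mapsto> \<integral>f dK(\<omega>)\<close> for bounded Borel \<open>f\<close>.\<close>

abbreviation real_kernel :: "'a measure \<Rightarrow> ('a \<Rightarrow> real measure) \<Rightarrow> bool" where
  "real_kernel M K \<equiv> K \<in> measurable M (prob_algebra borel)"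

lemma real_kernel_iff:
  "real_kernel M K \<longleftrightarrow>
     (\<forall>\<omega>\<in>space M. prob_space (K \<omega>) \<and> sets (K \<omega>) = sets borel) \<and>
     (\<forall>f\<in>borel_measurable borel. bounded (range f) \<longrightarrow>
        (\<lambda>\<omega>. \<integral>x. (f x :: real) \<partial>K \<omega>) \<in> borel_measurable M)"
  (is "?L \<longleftrightarrow> ?P \<and> ?Q")
proof
  assume L: ?L
  then have S: "K \<in> measurable M (subprob_algebra borel)"
    by (rule measurable_prob_algebraD)
  have ?P
  proof
    fix \<omega> assume "\<omega> \<in> space M"
    then show "prob_space (K \<omega>) \<and> sets (K \<omega>) = sets borel"
      using measurable_space[OF L] by (auto simp: space_prob_algebra)
  qed
  moreover have ?Q
    using S by (auto intro: measurable_compose[OF S integral_measurable_subprob_algebra])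
  ultimately show "?P \<and> ?Q" ..
next
  assume PQ: "?P \<and> ?Q"
  have "K \<in> measurable M (subprob_algebra borel)"
  proof (rule measurable_subprob_algebra)
    fix \<omega> assume w: "\<omega> \<in> space M"
    then show "subprob_space (K \<omega>)" "sets (K \<omega>) = sets borel"
      using PQ by (auto intro: prob_space_imp_subprob_space)
  next
    fix A :: "real set" assume A: "A \<in> sets borel"
    have "bounded (range (indicator A :: real \<Rightarrow> real))"
      by (rule boundedI[of _ 1]) (auto simp: indicator_def)
    then have "(\<lambda>\<omega>. \<integral>x. (indicator A x :: real) \<partial>K \<omega>) \<in> borel_measurable M"
      using PQ A by auto
    then have "(\<lambda>\<omega>. ennreal (\<integral>x. indicator A x \<partial>K \<omega>)) \<in> borel_measurable M"
      by measurable
    also have "?this \<longleftrightarrow> (\<lambda>\<omega>. emeasure (K \<omega>) A) \<in> borel_measurable M"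
    proof (rule measurable_cong)
      fix \<omega> assume w: "\<omega> \<in> space M"
      interpret prob_space "K \<omega>" using PQ w by auto
      have "sets (K \<omega>) = sets borel" using PQ w by auto
      then show "ennreal (\<integral>x. indicator A x \<partial>K \<omega>) = emeasure (K \<omega>) A"
        using A sets_eq_imp_space_eq[of "K \<omega>" borel] by (simp add: emeasure_eq_measure)
    qed
    finally show "(\<lambda>\<omega>. emeasure (K \<omega>) A) \<in> borel_measurable M" .
  qed
  then show ?L
    using PQ by (intro measurable_prob_algebraI) auto
qed

text \<open>\<open>uniform_measure M H\<close> is the conditional probability \<open>P(\<cdot> | H)\<close>, hence
  \<open>uniform_measure M H \<bind> K\<close> is the mixture \<open>E[K(\<cdot>) | H]\<close>; see the lemma below.\<close>

definition converges_stably ::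
  "'a measure \<Rightarrow> (nat \<Rightarrow> 'a \<Rightarrow> real) \<Rightarrow> ('a \<Rightarrow> real measure) \<Rightarrow> bool" where
  "converges_stably M Y K \<longleftrightarrow>
     (\<forall>t. Y t \<in> borel_measurable M) \<and> real_kernel M K \<and>
     (\<forall>H\<in>sets M. measure M H > 0 \<longrightarrow>
        weak_conv_m (\<lambda>t. distr (uniform_measure M H) borel (Y t)) (uniform_measure M H \<bind> K))"

lemma (in prob_space) emeasure_mixture:
  assumes K: "real_kernel M K" and H: "H \<in> sets M" "measure M H > 0" and B: "B \<in> sets borel"
  shows "emeasure (uniform_measure M H \<bind> K) B
    = (\<integral>\<^sup>+\<omega>. emeasure (K \<omega>) B * indicator H \<omega> \<partial>M) / emeasure M H"
proof -
  have S: "K \<in> measurable M (subprob_algebra borel)"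
    using K by (rule measurable_prob_algebraD)
  then have S': "K \<in> measurable (uniform_measure M H) (subprob_algebra borel)"
    by (simp add: measurable_def)
  have m: "(\<lambda>\<omega>. emeasure (K \<omega>) B) \<in> borel_measurable M"
    by (rule measurable_compose[OF S measurable_emeasure_subprob_algebra[OF B]])
  have "emeasure (uniform_measure M H \<bind> K) B = (\<integral>\<^sup>+\<omega>. emeasure (K \<omega>) B \<partial>uniform_measure M H)"
    by (rule emeasure_bind[OF _ S' B]) (simp add: not_empty)
  also have "\<dots> = (\<integral>\<^sup>+\<omega>. emeasure (K \<omega>) B * indicator H \<omega> \<partial>M) / emeasure M H"
    by (rule nn_integral_uniform_measure[OF m H(1)])
  finally show ?thesis .
qed

text \<open>\<open>gaussian0 v\<close> is the centred normal law with variance \<open>v\<close>. A negative \<open>v\<close> is treated as 0, so that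
  a variance that is nonnegative only almost surely still defines a kernel.
  The second parameter of \<open>normal_density\<close> is the standard deviation.\<close>

definition gaussian0 :: "real \<Rightarrow> real measure" where
  "gaussian0 v = (if 0 < v then density lborel (\<lambda>x. ennreal (normal_density 0 (sqrt v) x))
                  else return borel 0)"

definition gaussian_kernel :: "('a \<Rightarrow> real) \<Rightarrow> 'a \<Rightarrow> real measure" where
  "gaussian_kernel V \<omega> = gaussian0 (V \<omega>)"

end

theory Submission
  imports Defs "HOL-Real_Asymp.Real_Asymp"
begin

text \<open>
  Write \<open>D t\<close> for the deviation of urn \<open>j\<close> from the mean proportion at time \<open>t\<close> and \<open>m = a + b\<close>.
  All urns start equal, so \<open>D 0 = 0\<close>, and
  \<open>D (t+1) = (1 - \<alpha> / (m+t+1)) D t + X t / (m+t+1)\<close>, where \<open>X t\<close> is the conditionally centred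
  part of \<open>I (t+1) j - (1/N) (\<Sum>i. I (t+1) i)\<close>. Solving the recursion (\<open>deviation_eq\<close>) exhibits
  \<open>D t\<close> as a deterministic linear combination \<open>\<Sum>k<t. w t k * X k\<close> of bounded martingale
  differences. With \<open>s t = sqrt t\<close> when \<open>\<alpha> > 1/2\<close>, and \<open>s t = sqrt t / sqrt (ln t)\<close> when
  \<open>\<alpha> = 1/2\<close>, the squares of the scaled weights \<open>s t * w t k\<close> sum up to \<open>1 / (2\<alpha> - 1)\<close>,
  respectively \<open>1\<close>, in the limit, while the largest of them vanishes (\<open>scaled_weight_limits\<close>).
  The conditional variance of \<open>X t\<close> is a quadratic expression in the drawing probabilities of the
  urns. The same representation of the deviations shows that all urns merge with the mean in
  \<open>L\<^sup>1\<close>, so this variance converges in \<open>L\<^sup>1\<close> to \<open>(1 - 1/N) (Z - Z\<^sup>2)\<close>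
  (\<open>noise_var_contrast_tendsto\<close>). Stable convergence is thus an instance of a central limit
  theorem for weighted bounded martingale differences, \<open>stable_martingale_clt\<close>.

  That theorem is proved by McLeish's method. Since \<open>exp (i x) = (1 + i x) exp (- x\<^sup>2 / 2)\<close>
  up to an error of order \<open>\<bar>x\<bar>\<^sup>3\<close>, the exponential \<open>exp (i u S t)\<close> of the weighted sum is close to
  \<open>T t * exp (- u\<^sup>2 Q t / 2)\<close>, where \<open>T t\<close> is a product of factors \<open>1 + i u c X\<close> and \<open>Q t\<close> is the
  weighted sum of the squares of the differences. By orthogonality of martingale differences \<open>Q t\<close>
  has an \<open>L\<^sup>1\<close> limit \<open>\<tau> V\<close>. What is left is \<open>E (T t * W) \<rightarrow> E W\<close> for bounded \<open>W\<close>, here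
  \<open>W = 1\<^sub>H exp (- u\<^sup>2 \<tau> V / 2)\<close>. If \<open>W\<close> is known at time \<open>s\<close>, the later
  factors of \<open>T t\<close> integrate to one and the earlier ones tend to one. A general \<open>W\<close> may be replaced
  by \<open>E (W | F s)\<close> with \<open>s\<close> large, because \<open>T t\<close> is uniformly bounded and the
  martingale \<open>E (W | F s)\<close> is Cauchy in \<open>L\<^sup>2\<close> (\<open>expectation_mult_tendsto_of_adapted\<close>). As this
  allows an arbitrary event \<open>H\<close>, convergence is stable and not only in law, by Levy's continuity
  theorem (\<open>converges_stably_gaussianI\<close>).

  For the non-degeneracy, \<open>E (Z t * (1 - Z t))\<close> loses at most the factor \<open>1 - 1 / n\<^sup>2\<close> in the
  step to time \<open>t + 1\<close>, where \<open>n = m + t + 1\<close>. The product of these factors telescopes and stays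
  away from zero, so \<open>E (Z - Z\<^sup>2) > 0\<close>.
\<close>

section \<open>Weights of the linear recursion\<close>

text \<open>The Toeplitz lemma: a fixed initial segment of the averages vanishes because each single weight
  does, and on the remaining segment \<open>d\<close> is uniformly small while the total weight stays bounded.\<close>

lemma weighted_average_tendsto_0:
  fixes p :: "nat \<Rightarrow> nat \<Rightarrow> real" and d :: "nat \<Rightarrow> real"
  assumes nonneg: "\<And>t k. k < t \<Longrightarrow> 0 \<le> p t k"
    and bounded: "\<And>t. (\<Sum>k<t. p t k) \<le> C"
    and vanish: "\<And>k. (\<lambda>t. p t k) \<longlonglongrightarrow> 0"
    and d: "d \<longlonglongrightarrow> 0"
  shows "(\<lambda>t. \<Sum>k<t. p t k * d k) \<longlonglongrightarrow> 0"
proof (rule LIMSEQ_I)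
  fix r :: real assume r: "0 < r"
  have C: "0 \<le> C" using bounded[of 0] by simp
  define e where "e = r / (2 * (C + 1))"
  have e: "0 < e" using r C by (simp add: e_def)
  \<comment> \<open>The tail contributes at most \<open>C * e\<close>, and adding 1 to \<open>C\<close> keeps this strictly below \<open>r / 2\<close>.\<close>
  obtain s where s: "\<And>k. k \<ge> s \<Longrightarrow> \<bar>d k\<bar> < e"
    using LIMSEQ_D[OF d e] by auto
  have "(\<lambda>t. \<Sum>k<s. p t k * d k) \<longlonglongrightarrow> (\<Sum>k<s. 0 * d k)"
    by (intro tendsto_intros vanish)
  then have "(\<lambda>t. \<Sum>k<s. p t k * d k) \<longlonglongrightarrow> 0" by simp
  from LIMSEQ_D[OF this, of "r / 2"] r obtain n where
    n: "\<And>t. t \<ge> n \<Longrightarrow> \<bar>\<Sum>k<s. p t k * d k\<bar> < r / 2" by auto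
  show "\<exists>no. \<forall>t\<ge>no. norm ((\<Sum>k<t. p t k * d k) - 0) < r"
  proof (intro exI allI impI)
    fix t assume t: "max n s \<le> t"
    have "(\<Sum>k<t. p t k * d k) = (\<Sum>k<s. p t k * d k) + (\<Sum>k=s..<t. p t k * d k)"
      using t by (metis atLeast0LessThan max.bounded_iff sum.atLeastLessThan_concat zero_le)
    moreover have "\<bar>\<Sum>k=s..<t. p t k * d k\<bar> \<le> (\<Sum>k=s..<t. p t k * e)"
      using s nonneg
      by (intro order_trans[OF sum_abs] sum_mono) (auto simp: abs_mult intro!: mult_left_mono intro: less_imp_le)
    moreover have "(\<Sum>k=s..<t. p t k * e) \<le> (\<Sum>k<t. p t k * e)"
      using nonneg e by (intro sum_mono2) auto
    moreover have "(\<Sum>k<t. p t k * e) \<le> C * e"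
      using bounded[of t] e by (simp flip: sum_distrib_right)
    moreover have "C * e < r / 2" using C r by (simp add: e_def field_simps)
    ultimately show "norm ((\<Sum>k<t. p t k * d k) - 0) < r" using n[of t] t by simp
  qed
qed

text \<open>The quotient on the left is, up to the vanishing term \<open>B 0 / (\<Sum>k<t. a k)\<close>, the average of the
  quotients of increments with weights proportional to \<open>a\<close>.\<close>

lemma stolz_cesaro:
  fixes a B :: "nat \<Rightarrow> real"
  assumes pos: "\<And>k. 0 < a k"
    and div: "filterlim (\<lambda>t. \<Sum>k<t. a k) at_top sequentially"
    and inc: "(\<lambda>k. (B (Suc k) - B k) / a k) \<longlonglongrightarrow> \<rho>"
  shows "(\<lambda>t. B t / (\<Sum>k<t. a k)) \<longlonglongrightarrow> \<rho>"
proof -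
  define A where "A t = (\<Sum>k<t. a k)" for t
  have A0: "0 \<le> A t" for t unfolding A_def by (intro sum_nonneg less_imp_le pos)
  have inv: "(\<lambda>t. x / A t) \<longlonglongrightarrow> 0" for x
    using div unfolding A_def[symmetric]
    by (intro tendsto_divide_0[OF tendsto_const] filterlim_at_top_imp_at_infinity)
  have "(\<lambda>t. \<Sum>k<t. a k / A t * ((B (Suc k) - B k) / a k - \<rho>)) \<longlonglongrightarrow> 0"
  proof (rule weighted_average_tendsto_0[where C=1])
    show "(\<Sum>k<t. a k / A t) \<le> 1" for t
      by (simp flip: sum_divide_distrib A_def)
  next
    show "(\<lambda>k. (B (Suc k) - B k) / a k - \<rho>) \<longlonglongrightarrow> 0"
      using tendsto_diff[OF inc tendsto_const[of \<rho>]] by simp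
  qed (use inv A0 pos in \<open>auto simp: less_imp_le\<close>)
  then have "(\<lambda>t. (\<Sum>k<t. a k / A t * ((B (Suc k) - B k) / a k - \<rho>)) + B 0 / A t + \<rho>) \<longlonglongrightarrow> 0 + 0 + \<rho>"
    by (intro tendsto_intros inv)
  moreover have "\<forall>\<^sub>F t in sequentially.
      (\<Sum>k<t. a k / A t * ((B (Suc k) - B k) / a k - \<rho>)) + B 0 / A t + \<rho> = B t / A t"
  proof (rule eventually_sequentiallyI[of 1])
    fix t :: nat assume "1 \<le> t"
    then have At: "0 < A t" unfolding A_def by (intro sum_pos pos) (auto simp: lessThan_empty_iff)
    have "(\<Sum>k<t. a k / A t * ((B (Suc k) - B k) / a k - \<rho>))
        = (\<Sum>k<t. (B (Suc k) - B k) / A t - \<rho> * (a k / A t))"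
    proof (intro sum.cong refl)
      fix k
      have "a k \<noteq> 0" using pos[of k] by simp
      then have "a k / A t * ((B (Suc k) - B k) / a k) = (B (Suc k) - B k) / A t" by simp
      then show "a k / A t * ((B (Suc k) - B k) / a k - \<rho>) = (B (Suc k) - B k) / A t - \<rho> * (a k / A t)"
        by (simp add: right_diff_distrib)
    qed
    also have "\<dots> = (B t - B 0) / A t - \<rho> * (A t / A t)"
      unfolding sum_subtractf[of "\<lambda>k. (B (Suc k) - B k) / A t"]
      by (simp add: sum_lessThan_telescope A_def flip: sum_divide_distrib sum_distrib_left)
    finally show "(\<Sum>k<t. a k / A t * ((B (Suc k) - B k) / a k - \<rho>)) + B 0 / A t + \<rho> = B t / A t"
      using At by (simp add: field_simps)
  qed
  ultimately show ?thesis
    unfolding A_def[symmetric] by (auto elim: Lim_transform_eventually)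
qed

definition decay :: "real \<Rightarrow> real \<Rightarrow> nat \<Rightarrow> real" where
  "decay \<alpha> m t = (\<Prod>k<t. 1 - \<alpha> / (m + real (Suc k)))"

text \<open>The influence on the solution at time \<open>t\<close> of the perturbation that enters the recursion
  \<open>D (t+1) = (1 - \<alpha> / (m+t+1)) * D t + x t / (m+t+1)\<close> at time \<open>k\<close>.\<close>

definition weight :: "real \<Rightarrow> real \<Rightarrow> nat \<Rightarrow> nat \<Rightarrow> real" where
  "weight \<alpha> m t k = decay \<alpha> m t / (decay \<alpha> m (Suc k) * (m + real (Suc k)))"

lemma decay_Suc: "decay \<alpha> m (Suc t) = decay \<alpha> m t * (1 - \<alpha> / (m + real (Suc t)))"
  by (simp add: decay_def)

lemma decay_pos:
  assumes "\<alpha> \<le> 1" "0 < m" shows "0 < decay \<alpha> m t"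
  unfolding decay_def
proof (rule prod_pos)
  fix k
  have "\<alpha> < m + real (Suc k)" using assms by simp
  then show "0 < 1 - \<alpha> / (m + real (Suc k))" using assms by (simp add: field_simps)
qed

lemma recursion_solution:
  assumes "\<alpha> \<le> 1" "0 < m" and "D 0 = 0"
    and rec: "\<And>t. D (Suc t) = (1 - \<alpha> / (m + real (Suc t))) * D t + x t / (m + real (Suc t))"
  shows "D t = (\<Sum>k<t. weight \<alpha> m t k * x k)"
proof (induction t)
  case 0 then show ?case by (simp add: \<open>D 0 = 0\<close>)
next
  case (Suc t)
  have "decay \<alpha> m (Suc t) \<noteq> 0" using decay_pos[OF assms(1,2)] by (simp add: less_imp_neq[symmetric])
  then have "weight \<alpha> m (Suc t) t = 1 / (m + real (Suc t))" by (simp add: weight_def)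
  moreover have "(\<Sum>k<t. weight \<alpha> m (Suc t) k * x k)
      = (1 - \<alpha> / (m + real (Suc t))) * (\<Sum>k<t. weight \<alpha> m t k * x k)"
    unfolding sum_distrib_left weight_def decay_Suc[of \<alpha> m t]
    by (intro sum.cong refl) (simp add: mult_ac)
  ultimately show ?case by (simp add: rec Suc.IH)
qed

text \<open>For \<open>\<alpha> \<ge> 1/2\<close> each factor satisfies \<open>(1 - \<alpha> / n)\<^sup>2 \<le> (1 - 1 / (2 n))\<^sup>2 \<le> n / (n + 1)\<close>, and these
  bounds telescope. For \<open>\<alpha> < 1/2\<close> the left-hand side only decays like \<open>t powr (- 2 * \<alpha>)\<close>, slower than \<open>1 / t\<close>.\<close>

lemma decay_square_le:
  assumes \<alpha>: "1 / 2 \<le> \<alpha>" "\<alpha> \<le> 1" and m: "0 < m"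
  shows "(decay \<alpha> m t)\<^sup>2 \<le> (m + 1) / (m + real (Suc t))"
proof (induction t)
  case 0 then show ?case using m by (simp add: decay_def)
next
  case (Suc t)
  define n where "n = m + real (Suc t)"
  have n: "1 < n" using m by (simp add: n_def)
  have "0 \<le> 1 - \<alpha> / n" "1 - \<alpha> / n \<le> 1 - 1 / (2 * n)"
    using n \<alpha> by (auto simp: field_simps)
  then have "(1 - \<alpha> / n)\<^sup>2 \<le> (1 - 1 / (2 * n))\<^sup>2" by (intro power_mono)
  also have "\<dots> \<le> n / (n + 1)"
  proof -
    have "(1 - 1 / (2 * n))\<^sup>2 * (n + 1) = n - (3 * n - 1) / (4 * n\<^sup>2)"
      using n by (simp add: field_simps power2_eq_square)
    also have "\<dots> \<le> n" using n by simp
    finally show ?thesis using n by (simp add: field_simps)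
  qed
  finally have "(decay \<alpha> m (Suc t))\<^sup>2 \<le> (m + 1) / n * (n / (n + 1))"
    unfolding decay_Suc power_mult_distrib n_def[symmetric]
    using Suc.IH n m by (intro mult_mono) (auto simp: n_def)
  then show ?case using n by (simp add: n_def add_ac)
qed

text \<open>As \<open>\<alpha> \<le> 1\<close>, the factor \<open>1 - \<alpha> / (m+t)\<close> is at least \<open>(m+t-1) / (m+t)\<close>, so that
  \<open>decay \<alpha> m t * (m + t)\<close> is nondecreasing. This bounds all weights uniformly in \<open>k\<close>.\<close>

lemma decay_scaled_mono:
  assumes "\<alpha> \<le> 1" "0 < m"
  shows "m \<le> decay \<alpha> m t * (m + real t)"
proof (induction t)
  case 0 then show ?case by (simp add: decay_def)
next
  case (Suc t)
  have "decay \<alpha> m (Suc t) * (m + real (Suc t)) = decay \<alpha> m t * (m + real (Suc t) - \<alpha>)"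
    using assms by (simp add: decay_Suc field_simps)
  also have "\<dots> \<ge> decay \<alpha> m t * (m + real t)"
    using decay_pos[OF assms, of t] assms by (intro mult_left_mono) auto
  finally show ?case using Suc.IH by simp
qed

lemma weight_bounds:
  assumes "\<alpha> \<le> 1" "0 < m"
  shows "0 < weight \<alpha> m t k" "weight \<alpha> m t k \<le> decay \<alpha> m t / m"
proof -
  have *: "m \<le> decay \<alpha> m (Suc k) * (m + real (Suc k))" by (rule decay_scaled_mono[OF assms])
  show "0 < weight \<alpha> m t k"
    unfolding weight_def using * assms decay_pos[OF assms, of t] by (intro divide_pos_pos) linarith+
  show "weight \<alpha> m t k \<le> decay \<alpha> m t / m"
    unfolding weight_def using * assms decay_pos[OF assms, of t]
    by (intro divide_left_mono mult_pos_pos decay_pos) (auto simp: add_pos_nonneg)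
qed

text \<open>By the bound on \<open>decay\<close>, the summands dominate a multiple of the harmonic series.\<close>

lemma inverse_weight_sum_at_top:
  assumes \<alpha>: "1 / 2 \<le> \<alpha>" "\<alpha> \<le> 1" and m: "0 < m"
  shows "filterlim (\<lambda>t. \<Sum>k<t. 1 / (decay \<alpha> m (Suc k) * (m + real (Suc k)))\<^sup>2) at_top sequentially"
proof (rule filterlim_at_top_mono)
  have "filterlim (\<lambda>t. 1 / (m + 1)\<^sup>2 * harm t) at_top sequentially"
    using m by (intro filterlim_tendsto_pos_mult_at_top[OF tendsto_const _ harm_at_top]) auto
  then show "filterlim (\<lambda>t. \<Sum>k<t. 1 / (m + 1)\<^sup>2 * (1 / real (Suc k))) at_top sequentially"
    unfolding harm_altdef sum_distrib_left inverse_eq_divide .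
next
  show "\<forall>\<^sub>F t in sequentially. (\<Sum>k<t. 1 / (m + 1)\<^sup>2 * (1 / real (Suc k)))
      \<le> (\<Sum>k<t. 1 / (decay \<alpha> m (Suc k) * (m + real (Suc k)))\<^sup>2)"
  proof (intro always_eventually allI sum_mono)
    fix k :: nat
    define n where "n = m + real (Suc k)"
    have n: "0 < n" "n \<le> (m + 1) * real (Suc k)" using m by (simp_all add: n_def algebra_simps)
    have "(decay \<alpha> m (Suc k) * n)\<^sup>2 \<le> (m + 1) / (n + 1) * n\<^sup>2"
      unfolding power_mult_distrib using decay_square_le[OF assms, of "Suc k"]
      by (intro mult_right_mono) (auto simp: n_def add_ac)
    also have "\<dots> \<le> (m + 1) * n"
      using n m by (simp add: field_simps power2_eq_square)
    also have "\<dots> \<le> (m + 1)\<^sup>2 * real (Suc k)"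
      using n m by (simp add: power2_eq_square mult_left_mono mult.assoc)
    finally have "1 / ((m + 1)\<^sup>2 * real (Suc k)) \<le> 1 / (decay \<alpha> m (Suc k) * n)\<^sup>2"
      using decay_pos[of \<alpha> m "Suc k"] assms n by (intro divide_left_mono) auto
    then show "1 / (m + 1)\<^sup>2 * (1 / real (Suc k)) \<le> 1 / (decay \<alpha> m (Suc k) * (m + real (Suc k)))\<^sup>2"
      by (simp add: n_def)
  qed
qed

text \<open>The sum of the squared scaled weights equals \<open>A t / B t\<close> with \<open>A t\<close> the divergent sum of
  \<open>inverse_weight_sum_at_top\<close> and \<open>B t = 1 / (s t * decay \<alpha> m t)\<^sup>2\<close>. The hypothesis is the
  convergence of the quotients of increments of \<open>B\<close> and \<open>A\<close>, so the limit comes from the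
  Stolz-Cesaro theorem. It is a statement about explicit sequences, free of \<open>decay\<close>.\<close>

lemma scaled_weight_limits:
  fixes s :: "nat \<Rightarrow> real"
  assumes \<alpha>: "1 / 2 \<le> \<alpha>" "\<alpha> \<le> 1" and m: "0 < m" and \<rho>: "0 < \<rho>"
    and lim: "(\<lambda>k. (m + real (Suc k))\<^sup>2
        * (1 / (s (Suc k))\<^sup>2 - (1 - \<alpha> / (m + real (Suc k)))\<^sup>2 / (s k)\<^sup>2)) \<longlonglongrightarrow> \<rho>"
  shows "(\<lambda>t. s t * decay \<alpha> m t) \<longlonglongrightarrow> 0"
    and "(\<lambda>t. \<Sum>k<t. (s t * weight \<alpha> m t k)\<^sup>2) \<longlonglongrightarrow> 1 / \<rho>"
proof -
  define a where "a k = 1 / (decay \<alpha> m (Suc k) * (m + real (Suc k)))\<^sup>2" for k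
  define A where "A t = (\<Sum>k<t. a k)" for t
  define B where "B t = 1 / (s t * decay \<alpha> m t)\<^sup>2" for t
  have dpos: "0 < decay \<alpha> m t" for t using decay_pos \<alpha> m by auto
  have a: "0 < a k" for k using dpos[of "Suc k"] m by (simp add: a_def)
  have A: "filterlim A at_top sequentially"
    unfolding A_def a_def by (rule inverse_weight_sum_at_top[OF \<alpha> m])
  have "(\<lambda>t. B t / A t) \<longlonglongrightarrow> \<rho>"
    unfolding A_def
  proof (rule stolz_cesaro[OF a])
    \<comment> \<open>This also holds where \<open>s\<close> vanishes, as at time 0, because both sides then use \<open>1 / 0 = 0\<close>.\<close>
    have "(B (Suc k) - B k) / a k = (m + real (Suc k))\<^sup>2
        * (1 / (s (Suc k))\<^sup>2 - (1 - \<alpha> / (m + real (Suc k)))\<^sup>2 / (s k)\<^sup>2)" for k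
    proof -
      define n q where "n = m + real (Suc k)" and "q = 1 - \<alpha> / n"
      have "q \<noteq> 0" using dpos[of "Suc k"] by (auto simp: decay_Suc n_def q_def)
      then show ?thesis
        using dpos[of k] unfolding B_def a_def decay_Suc n_def[symmetric] q_def[symmetric]
        by (simp add: power_mult_distrib field_simps)
    qed
    then show "(\<lambda>k. (B (Suc k) - B k) / a k) \<longlonglongrightarrow> \<rho>" using lim by simp
  qed (use A in \<open>simp add: A_def[abs_def]\<close>)
  then have "(\<lambda>t. 1 / (B t / A t)) \<longlonglongrightarrow> 1 / \<rho>" using \<rho> by (intro tendsto_intros) auto
  then have AB: "(\<lambda>t. (s t * decay \<alpha> m t)\<^sup>2 * A t) \<longlonglongrightarrow> 1 / \<rho>" by (simp add: B_def mult.commute)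
  moreover have "(\<Sum>k<t. (s t * weight \<alpha> m t k)\<^sup>2) = (s t * decay \<alpha> m t)\<^sup>2 * A t" for t
    by (simp add: A_def a_def weight_def sum_distrib_left power_mult_distrib power_divide)
  ultimately show "(\<lambda>t. \<Sum>k<t. (s t * weight \<alpha> m t k)\<^sup>2) \<longlonglongrightarrow> 1 / \<rho>" by simp
  have "(\<lambda>t. (s t * decay \<alpha> m t)\<^sup>2 * A t / A t) \<longlonglongrightarrow> 0"
    by (rule tendsto_divide_0[OF AB filterlim_at_top_imp_at_infinity[OF A]])
  moreover have "\<forall>\<^sub>F t in sequentially. (s t * decay \<alpha> m t)\<^sup>2 * A t / A t = (s t * decay \<alpha> m t)\<^sup>2"
    using filterlim_at_top_dense[THEN iffD1, OF A, rule_format, of 0] by eventually_elim simp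
  ultimately have "(\<lambda>t. (s t * decay \<alpha> m t)\<^sup>2) \<longlonglongrightarrow> 0" by (rule Lim_transform_eventually)
  then show "(\<lambda>t. s t * decay \<alpha> m t) \<longlonglongrightarrow> 0"
    using tendsto_real_sqrt by (fastforce simp: tendsto_rabs_zero_iff)
qed

text \<open>The limits \<open>\<rho>\<close> required for the two scalings. Their reciprocals are the factors \<open>1 / (2\<alpha> - 1)\<close>
  and \<open>1\<close> in the asymptotic variances.\<close>

lemma sqrt_scaling_limit:
  fixes \<alpha> m :: real
  shows "(\<lambda>k. (m + real (Suc k))\<^sup>2
        * (1 / (sqrt (real (Suc k)))\<^sup>2 - (1 - \<alpha> / (m + real (Suc k)))\<^sup>2 / (sqrt (real k))\<^sup>2)) \<longlonglongrightarrow> 2 * \<alpha> - 1"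
  by simp real_asymp

lemma sqrt_log_scaling_limit:
  fixes m :: real
  shows "(\<lambda>k. (m + real (Suc k))\<^sup>2
        * (1 / (sqrt (real (Suc k)) / sqrt (ln (real (Suc k))))\<^sup>2
           - (1 - (1 / 2) / (m + real (Suc k)))\<^sup>2 / (sqrt (real k) / sqrt (ln (real k)))\<^sup>2)) \<longlonglongrightarrow> 1"
  by real_asymp

section \<open>Elementary estimates for exponentials\<close>

lemma norm_one_plus_i_le:
  fixes x :: real
  shows "cmod (1 + \<i> * x) \<le> exp (x\<^sup>2 / 2)"
proof (rule power2_le_imp_le)
  have "(cmod (1 + \<i> * x))\<^sup>2 = 1 + x\<^sup>2" by (simp add: cmod_power2)
  also have "\<dots> \<le> exp (x\<^sup>2)" using exp_ge_add_one_self by simp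
  also have "\<dots> = (exp (x\<^sup>2 / 2))\<^sup>2" by (simp flip: exp_double)
  finally show "(cmod (1 + \<i> * x))\<^sup>2 \<le> (exp (x\<^sup>2 / 2))\<^sup>2" .
qed simp

text \<open>The McLeish approximation of \<open>exp (i x)\<close> does not leave the unit disc, which is what makes
  products of such factors comparable with products of exponentials.\<close>

lemma norm_mcleish_factor:
  fixes x :: real
  shows "cmod ((1 + \<i> * x) * exp (- (x\<^sup>2) / 2)) \<le> 1"
proof -
  have "cmod (1 + \<i> * x) * exp (- (x\<^sup>2) / 2) \<le> exp (x\<^sup>2 / 2) * exp (- (x\<^sup>2) / 2)"
    by (intro mult_right_mono norm_one_plus_i_le) simp
  then show ?thesis by (simp add: norm_mult flip: exp_add)
qed

text \<open>For small \<open>x\<close> both expressions have the same Taylor polynomial of degree two. For large \<open>x\<close> both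
  have modulus at most one.\<close>

lemma iexp_second_order:
  fixes x :: real
  shows "cmod (iexp x - (1 + \<i> * x) * exp (- (x\<^sup>2) / 2)) \<le> 2 * \<bar>x\<bar> ^ 3"
proof (cases "\<bar>x\<bar> \<le> 1")
  case True
  define y where "y = exp (- (x\<^sup>2) / 2) - (1 - x\<^sup>2 / 2)"
  have "iexp x - (1 + \<i> * x) * exp (- (x\<^sup>2) / 2)
      = (iexp x - (\<Sum>k\<le>2. (\<i> * x)^k / fact k)) + (\<i> * of_real (x^3 / 2) - (1 + \<i> * x) * of_real y)"
    by (simp add: y_def eval_nat_numeral algebra_simps exp_of_real)
  also have "cmod \<dots> \<le> \<bar>x\<bar>^3 / 6 + (\<bar>x\<bar>^3 / 2 + 2 * (\<bar>x\<bar>^3 / 4))"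
  proof (rule order_trans[OF norm_triangle_ineq], rule add_mono,
      rule_tac [2] order_trans[OF norm_triangle_ineq4], rule_tac [2] add_mono)
    show "cmod (iexp x - (\<Sum>k\<le>2. (\<i> * x)^k / fact k)) \<le> \<bar>x\<bar>^3 / 6"
      using iexp_approx1[of x 2] by (simp add: eval_nat_numeral)
    show "cmod (\<i> * of_real (x^3 / 2)) \<le> \<bar>x\<bar>^3 / 2"
      by (simp add: norm_mult norm_power norm_divide)
    have "cmod (1 + \<i> * x) \<le> 2" using norm_triangle_ineq[of 1 "\<i> * x"] True by (simp add: norm_mult)
    moreover have "\<bar>y\<bar> \<le> \<bar>x\<bar>^3 / 4"
    proof -
      have "0 \<le> y" using exp_ge_add_one_self[of "- (x\<^sup>2) / 2"] by (simp add: y_def)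
      have "exp (- (x\<^sup>2) / 2) * (1 + x\<^sup>2 / 2) \<le> 1"
        using exp_ge_add_one_self[of "x\<^sup>2 / 2"] by (simp add: exp_minus field_simps)
      then have "exp (- (x\<^sup>2) / 2) \<le> 1 / (1 + x\<^sup>2 / 2)"
        by (simp add: field_simps pos_le_divide_eq add_pos_nonneg)
      also have "\<dots> \<le> 1 - x\<^sup>2 / 2 + (x\<^sup>2)\<^sup>2 / 4"
      proof -
        have "(1 - x\<^sup>2 / 2 + (x\<^sup>2)\<^sup>2 / 4) * (1 + x\<^sup>2 / 2) = 1 + (x^3)\<^sup>2 / 8"
          by (simp add: algebra_simps eval_nat_numeral)
        then have "1 \<le> (1 - x\<^sup>2 / 2 + (x\<^sup>2)\<^sup>2 / 4) * (1 + x\<^sup>2 / 2)" by simp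
        then show ?thesis by (simp add: pos_divide_le_eq add_pos_nonneg)
      qed
      finally have "y \<le> \<bar>x\<bar>^4 / 4" by (simp add: y_def)
      also have "\<bar>x\<bar>^4 \<le> \<bar>x\<bar>^3" using True by (intro power_decreasing) auto
      finally show ?thesis using \<open>0 \<le> y\<close> by simp
    qed
    ultimately show "cmod ((1 + \<i> * x) * of_real y) \<le> 2 * (\<bar>x\<bar>^3 / 4)"
      unfolding norm_mult by (intro mult_mono) auto
  qed
  also have "\<dots> \<le> 2 * \<bar>x\<bar>^3" by simp
  finally show ?thesis .
next
  case False
  have "cmod (iexp x - (1 + \<i> * x) * exp (- (x\<^sup>2) / 2)) \<le> 1 + 1"
    using norm_triangle_ineq4[of "iexp x" "(1 + \<i> * x) * exp (- (x\<^sup>2) / 2)"] norm_mcleish_factor[of x] by simp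
  also have "1 + 1 \<le> 2 * \<bar>x\<bar>^3" using False one_le_power[of "\<bar>x\<bar>" 3] by simp
  finally show ?thesis .
qed

lemma abs_exp_diff_le:
  fixes x y :: real
  assumes "0 \<le> x" "0 \<le> y"
  shows "\<bar>exp (- x) - exp (- y)\<bar> \<le> \<bar>x - y\<bar>"
proof -
  have *: "exp (- x) - exp (- y) \<le> y - x" if "0 \<le> x" "x \<le> y" for x y :: real
  proof -
    have le: "1 - exp (- (y - x)) \<le> y - x" using exp_ge_add_one_self[of "- (y - x)"] by linarith
    have "exp (- x) * (1 - exp (- (y - x))) \<le> 1 * (y - x)"
      by (rule mult_mono[OF _ le]) (use that in auto)
    then show ?thesis by (simp add: right_diff_distrib flip: exp_add)
  qed
  show ?thesis
    using *[of x y] *[of y x] assms by (cases "x \<le> y") auto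
qed

section \<open>Stable convergence to a Gaussian kernel through characteristic functions\<close>

text \<open>Writing the normal law as an image of the standard normal law treats all variances uniformly,
  including the degenerate case. Measurability of the kernel and its characteristic function
  both follow from this form.\<close>

lemma gaussian0_eq_distr:
  "gaussian0 v = distr std_normal_distribution borel (\<lambda>x. sqrt (max 0 v) * x)"
proof -
  interpret real_distribution std_normal_distribution by (rule real_dist_normal_dist)
  show ?thesis
  proof (cases "0 < v")
    case True
    have "distributed std_normal_distribution lborel (\<lambda>x. x) std_normal_density"
      by (simp add: distributed_def distr_id2[unfolded id_def])
    from normal_density_affine[OF this, of "sqrt v" 0] True
    have "distributed std_normal_distribution lborel (\<lambda>x. 0 + sqrt v * x) (normal_density 0 (sqrt v))"
      by simp
    then have "density lborel (\<lambda>x. ennreal (normal_density 0 (sqrt v) x))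
        = distr std_normal_distribution lborel (\<lambda>x. sqrt v * x)"
      by (simp add: distributed_def)
    also have "\<dots> = distr std_normal_distribution borel (\<lambda>x. sqrt v * x)"
      by (intro distr_cong) auto
    finally show ?thesis using True by (simp add: gaussian0_def)
  next
    case False
    then show ?thesis using distr_const[of 0 borel] by (simp add: gaussian0_def)
  qed
qed

lemma char_gaussian0: "char (gaussian0 v) u = exp (- (u\<^sup>2 / 2) * max 0 v)"
proof -
  have "char (gaussian0 v) u = char std_normal_distribution (u * sqrt (max 0 v))"
    unfolding gaussian0_eq_distr char_def
    by (subst integral_distr) (auto simp: mult_ac)
  then show ?thesis
    by (simp add: char_std_normal_distribution power_mult_distrib)
qed

lemma real_distribution_gaussian0: "real_distribution (gaussian0 v)"
proof -
  interpret real_distribution std_normal_distribution by (rule real_dist_normal_dist)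
  show ?thesis unfolding gaussian0_eq_distr by (rule real_distribution_distr) simp
qed

lemma real_kernel_gaussian_kernel:
  assumes [measurable]: "V \<in> borel_measurable M"
  shows "real_kernel M (gaussian_kernel V)"
proof -
  interpret real_distribution std_normal_distribution by (rule real_dist_normal_dist)
  have "std_normal_distribution \<in> space (prob_algebra borel)"
    by (simp add: space_prob_algebra prob_space_axioms)
  then have "(\<lambda>_. std_normal_distribution) \<in> M \<rightarrow>\<^sub>M prob_algebra borel" by simp
  then have "(\<lambda>\<omega>. distr std_normal_distribution borel (\<lambda>x. sqrt (max 0 (V \<omega>)) * x)) \<in> M \<rightarrow>\<^sub>M prob_algebra borel"
    by (rule measurable_distr_prob_space2) measurable
  then show ?thesis
    unfolding gaussian_kernel_def gaussian0_eq_distr .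
qed

lemma (in prob_space) integral_uniform_measure:
  fixes f :: "'a \<Rightarrow> 'b::{banach, second_countable_topology}"
  assumes [measurable]: "H \<in> sets M" "f \<in> borel_measurable M" and pos: "0 < measure M H"
  shows "integral\<^sup>L (uniform_measure M H) f = (1 / measure M H) *\<^sub>R (\<integral>\<omega>. indicator H \<omega> *\<^sub>R f \<omega> \<partial>M)"
proof -
  have "uniform_measure M H = density M (\<lambda>x. ennreal (indicator H x / measure M H))"
    unfolding uniform_measure_def using pos
    by (intro density_cong) (auto simp: emeasure_eq_measure divide_ennreal split: split_indicator simp flip: ennreal_1)
  then have "integral\<^sup>L (uniform_measure M H) f = (\<integral>\<omega>. (indicator H \<omega> / measure M H) *\<^sub>R f \<omega> \<partial>M)"
    using pos by (simp add: integral_density)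
  also have "\<dots> = (\<integral>\<omega>. (1 / measure M H) *\<^sub>R (indicator H \<omega> *\<^sub>R f \<omega>) \<partial>M)" by simp
  finally show ?thesis by (simp only: integral_scaleR_right)
qed

lemma (in prob_space) real_distribution_gaussian_mixture:
  assumes "V \<in> borel_measurable M"
  shows "real_distribution (M \<bind> gaussian_kernel V)"
proof -
  note K = measurable_prob_algebraD[OF real_kernel_gaussian_kernel[OF assms]]
  have "prob_space (M \<bind> gaussian_kernel V)"
    using real_distribution_gaussian0
    by (intro prob_space_bind[OF _ K]) (auto simp: gaussian_kernel_def real_distribution_def)
  moreover have "sets (M \<bind> gaussian_kernel V) = sets borel"
    using not_empty by (intro sets_bind) (auto simp: gaussian_kernel_def gaussian0_eq_distr)
  ultimately show ?thesis
    by (simp add: real_distribution_def real_distribution_axioms_def)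
qed

lemma (in prob_space) char_gaussian_mixture:
  assumes [measurable]: "V \<in> borel_measurable M" "H \<in> sets M" and pos: "0 < measure M H"
  shows "char (uniform_measure M H \<bind> gaussian_kernel V) u
    = (1 / measure M H) *\<^sub>R complex_of_real (\<integral>\<omega>. indicator H \<omega> * exp (- (u\<^sup>2 / 2) * max 0 (V \<omega>)) \<partial>M)"
    (is "char ?\<nu> u = _")
proof -
  interpret U: prob_space "uniform_measure M H"
    using pos by (intro prob_space_uniform_measure) (auto simp: emeasure_eq_measure)
  have V: "V \<in> borel_measurable (uniform_measure M H)" by simp
  note K = real_kernel_gaussian_kernel[OF V]
  interpret \<nu>: real_distribution ?\<nu>
    using U.real_distribution_gaussian_mixture[OF V] .
  interpret G: real_distribution "gaussian_kernel V \<omega>" for \<omega>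
    unfolding gaussian_kernel_def by (rule real_distribution_gaussian0)
  have bind: "(\<integral>x. f x \<partial>?\<nu>) = (\<integral>\<omega>. (\<integral>x. f x \<partial>gaussian_kernel V \<omega>) \<partial>uniform_measure M H)"
    if "f \<in> borel_measurable borel" "\<And>x. \<bar>f x\<bar> \<le> 1" for f :: "real \<Rightarrow> real"
    using that measurable_prob_algebraD[OF K] G.emeasure_space_1
    by (intro integral_bind[where B=1 and B'=1 and K=borel])
       (auto simp: U.finite_measure_axioms)
  have intG: "integrable (gaussian_kernel V \<omega>) (\<lambda>x. iexp (u * x))" for \<omega>
    using G.integrable_iexp[of "\<lambda>x. complex_of_real (u * x)"] by simp
  have "Re (char ?\<nu> u) = (\<integral>x. cos (u * x) \<partial>?\<nu>)"
    unfolding char_def by (subst integral_Re[symmetric]) (auto intro: \<nu>.integrable_iexp simp: Re_exp)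
  also have "\<dots> = (\<integral>\<omega>. Re (char (gaussian_kernel V \<omega>) u) \<partial>uniform_measure M H)"
    unfolding char_def using intG by (subst bind) (auto simp flip: integral_Re simp: Re_exp)
  finally have re: "Re (char ?\<nu> u) = (\<integral>\<omega>. exp (- (u\<^sup>2 / 2) * max 0 (V \<omega>)) \<partial>uniform_measure M H)"
    by (simp add: gaussian_kernel_def char_gaussian0)
  have "Im (char ?\<nu> u) = (\<integral>x. sin (u * x) \<partial>?\<nu>)"
    unfolding char_def by (subst integral_Im[symmetric]) (auto intro: \<nu>.integrable_iexp simp: Im_exp)
  also have "\<dots> = (\<integral>\<omega>. Im (char (gaussian_kernel V \<omega>) u) \<partial>uniform_measure M H)"
    unfolding char_def using intG by (subst bind) (auto simp flip: integral_Im simp: Im_exp)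
  finally have im: "Im (char ?\<nu> u) = 0"
    by (simp add: gaussian_kernel_def char_gaussian0)
  show ?thesis
    using re im pos by (simp add: complex_eq_iff integral_uniform_measure)
qed

text \<open>Levy's continuity theorem under each conditional probability \<open>P( \<cdot> | H)\<close>, with the constant factor
  \<open>1 / P(H)\<close> cleared. The kernel contributes the characteristic function of the variance
  mixture of normal laws.\<close>

lemma (in prob_space) converges_stably_gaussianI:
  assumes Y [measurable]: "\<And>t. Y t \<in> borel_measurable M" and V [measurable]: "V \<in> borel_measurable M"
    and lim: "\<And>H u. H \<in> sets M \<Longrightarrow> (\<lambda>t. \<integral>\<omega>. indicator H \<omega> *\<^sub>R iexp (u * Y t \<omega>) \<partial>M)
       \<longlonglongrightarrow> complex_of_real (\<integral>\<omega>. indicator H \<omega> * exp (- (u\<^sup>2 / 2) * max 0 (V \<omega>)) \<partial>M)"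
  shows "converges_stably M Y (gaussian_kernel V)"
  unfolding converges_stably_def
proof (intro conjI allI ballI impI)
  fix H assume H [measurable]: "H \<in> sets M" and pos: "0 < measure M H"
  interpret U: prob_space "uniform_measure M H"
    using pos by (intro prob_space_uniform_measure) (auto simp: emeasure_eq_measure)
  show "weak_conv_m (\<lambda>t. distr (uniform_measure M H) borel (Y t)) (uniform_measure M H \<bind> gaussian_kernel V)"
  proof (rule levy_continuity)
    show "real_distribution (distr (uniform_measure M H) borel (Y t))" for t
      by (intro U.real_distribution_distr) simp
    show "real_distribution (uniform_measure M H \<bind> gaussian_kernel V)"
      by (rule U.real_distribution_gaussian_mixture) simp
    fix u
    have "char (distr (uniform_measure M H) borel (Y t)) u
        = (1 / measure M H) *\<^sub>R (\<integral>\<omega>. indicator H \<omega> *\<^sub>R iexp (u * Y t \<omega>) \<partial>M)" for t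
      unfolding char_def using pos
      by (subst integral_distr) (auto simp: integral_uniform_measure)
    then show "(\<lambda>t. char (distr (uniform_measure M H) borel (Y t)) u)
        \<longlonglongrightarrow> char (uniform_measure M H \<bind> gaussian_kernel V) u"
      using tendsto_scaleR[OF tendsto_const lim[OF H, of u], of "1 / measure M H"]
      by (simp add: char_gaussian_mixture[OF V H pos])
  qed
qed (use Y real_kernel_gaussian_kernel[OF V] in auto)

section \<open>Bounded martingale differences\<close>

lemma (in prob_space) integrable_bounded:
  fixes f :: "'a \<Rightarrow> 'b::{banach, second_countable_topology}"
  assumes "f \<in> borel_measurable M" "\<And>\<omega>. \<omega> \<in> space M \<Longrightarrow> norm (f \<omega>) \<le> B"
  shows "integrable M f"
  using assms by (intro integrable_const_bound[of _ B]) auto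

lemma (in prob_space) integrable_mult_bounded:
  fixes f g :: "'a \<Rightarrow> real"
  assumes "f \<in> borel_measurable M" "g \<in> borel_measurable M"
    and f: "\<And>\<omega>. \<omega> \<in> space M \<Longrightarrow> \<bar>f \<omega>\<bar> \<le> B" and g: "\<And>\<omega>. \<omega> \<in> space M \<Longrightarrow> \<bar>g \<omega>\<bar> \<le> C"
  shows "integrable M (\<lambda>\<omega>. f \<omega> * g \<omega>)"
proof (rule integrable_bounded[where B="B * C"])
  fix \<omega> assume w: "\<omega> \<in> space M"
  show "norm (f \<omega> * g \<omega>) \<le> B * C"
    unfolding norm_mult using f[OF w] g[OF w]
    by (intro mult_mono) (auto intro: order_trans[OF abs_ge_zero])
qed (use assms in simp)

lemma (in prob_space) norm_expectation_le:
  fixes f :: "'a \<Rightarrow> 'b::{banach, second_countable_topology}" and g :: "'a \<Rightarrow> real"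
  assumes "integrable M f" "integrable M g" "\<And>\<omega>. \<omega> \<in> space M \<Longrightarrow> norm (f \<omega>) \<le> g \<omega>"
  shows "norm (\<integral>\<omega>. f \<omega> \<partial>M) \<le> (\<integral>\<omega>. g \<omega> \<partial>M)"
  using assms by (intro order_trans[OF integral_norm_bound integral_mono]) auto

lemma (in prob_space) expectation_abs_le_sqrt:
  fixes f :: "'a \<Rightarrow> real"
  assumes "integrable M f" "integrable M (\<lambda>\<omega>. (f \<omega>)\<^sup>2)"
  shows "(\<integral>\<omega>. \<bar>f \<omega>\<bar> \<partial>M) \<le> sqrt (\<integral>\<omega>. (f \<omega>)\<^sup>2 \<partial>M)"
proof (rule real_le_rsqrt)
  have "0 \<le> variance (\<lambda>\<omega>. \<bar>f \<omega>\<bar>)" by (rule variance_positive)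
  then show "(\<integral>\<omega>. \<bar>f \<omega>\<bar> \<partial>M)\<^sup>2 \<le> (\<integral>\<omega>. (f \<omega>)\<^sup>2 \<partial>M)"
    using assms by (subst (asm) variance_eq) auto
qed

locale filtered_prob_space = prob_space M for M :: "'a measure" +
  fixes F :: "nat \<Rightarrow> 'a measure"
  assumes subalgebra_F: "subalgebra M (F k)"
    and sets_F_mono: "k \<le> l \<Longrightarrow> sets (F k) \<subseteq> sets (F l)"
begin

sublocale cond: finite_measure_subalgebra M "F k" for k
  by unfold_locales (rule subalgebra_F)

lemma space_F: "space (F k) = space M"
  using subalgebra_F[of k] by (simp add: subalgebra_def)

lemma measurable_F: "f \<in> measurable (F k) N \<Longrightarrow> f \<in> measurable M N"
  by (rule measurable_from_subalg[OF subalgebra_F])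

lemma measurable_F_mono: "f \<in> measurable (F k) N \<Longrightarrow> k \<le> l \<Longrightarrow> f \<in> measurable (F l) N"
  by (rule measurable_from_subalg[of "F l" "F k"]) (simp_all add: subalgebra_def space_F sets_F_mono)

text \<open>Bounded martingale differences. The index is shifted so that \<open>X k\<close> belongs to the step from time
  \<open>k\<close> to time \<open>k + 1\<close>: it is known at time \<open>Suc k\<close> and centred given \<open>F k\<close>.\<close>

definition bounded_mds :: "real \<Rightarrow> (nat \<Rightarrow> 'a \<Rightarrow> real) \<Rightarrow> bool" where
  "bounded_mds L X \<longleftrightarrow> (\<forall>k. X k \<in> borel_measurable (F (Suc k)) \<and> (\<forall>\<omega>\<in>space M. \<bar>X k \<omega>\<bar> \<le> L)
     \<and> (AE \<omega> in M. real_cond_exp M (F k) (X k) \<omega> = 0))"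

lemma bounded_mdsI:
  assumes meas: "\<And>k. X k \<in> borel_measurable (F (Suc k))"
    and bd: "\<And>k \<omega>. \<omega> \<in> space M \<Longrightarrow> \<bar>X k \<omega>\<bar> \<le> L"
    and orth: "\<And>k A. A \<in> sets (F k) \<Longrightarrow> (\<integral>\<omega>. indicator A \<omega> * X k \<omega> \<partial>M) = 0"
  shows "bounded_mds L X"
  unfolding bounded_mds_def
proof (intro allI conjI ballI meas bd)
  fix k
  have "integrable M (X k)"
    using measurable_F[OF meas] bd by (intro integrable_bounded[where B=L]) auto
  then show "AE \<omega> in M. real_cond_exp M (F k) (X k) \<omega> = 0"
    using orth by (intro cond.real_cond_exp_charact) (auto simp: set_lebesgue_integral_def)
qed

lemma bounded_mdsD:
  assumes "bounded_mds L X"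
  shows "k < n \<Longrightarrow> X k \<in> borel_measurable (F n)" "X k \<in> borel_measurable M"
    "\<omega> \<in> space M \<Longrightarrow> \<bar>X k \<omega>\<bar> \<le> L" "0 \<le> L"
proof -
  have *: "X k \<in> borel_measurable (F (Suc k))" using assms unfolding bounded_mds_def by blast
  then show "k < n \<Longrightarrow> X k \<in> borel_measurable (F n)" by (rule measurable_F_mono) simp
  from * show "X k \<in> borel_measurable M" by (rule measurable_F)
  show b: "\<omega> \<in> space M \<Longrightarrow> \<bar>X k \<omega>\<bar> \<le> L" for \<omega> k
    using assms unfolding bounded_mds_def by auto
  obtain \<omega> where "\<omega> \<in> space M" using not_empty by auto
  with b[of \<omega> 0] show "0 \<le> L" by linarith
qed

lemma expectation_mult_mds:
  fixes G :: "'a \<Rightarrow> real"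
  assumes X: "bounded_mds L X" and G: "G \<in> borel_measurable (F k)"
    and bd: "\<And>\<omega>. \<omega> \<in> space M \<Longrightarrow> \<bar>G \<omega>\<bar> \<le> B"
  shows "(\<integral>\<omega>. G \<omega> * X k \<omega> \<partial>M) = 0"
proof -
  note m[measurable] = bounded_mdsD(2)[OF X] measurable_F[OF G]
  have "integrable M (\<lambda>\<omega>. G \<omega> * X k \<omega>)"
  proof (rule integrable_bounded[where B="B * L"])
    fix \<omega> assume "\<omega> \<in> space M"
    from bd[OF this] bounded_mdsD(3)[OF X this, of k] bounded_mdsD(4)[OF X]
    show "norm (G \<omega> * X k \<omega>) \<le> B * L" by (simp add: abs_mult mult_mono)
  qed simp
  then have "(\<integral>\<omega>. G \<omega> * X k \<omega> \<partial>M) = (\<integral>\<omega>. G \<omega> * real_cond_exp M (F k) (X k) \<omega> \<partial>M)"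
    using cond.real_cond_exp_intg(2)[of G "X k" k] G by simp
  also have "\<dots> = (\<integral>\<omega>. 0 \<partial>M)"
    using X unfolding bounded_mds_def by (intro integral_cong_AE) auto
  finally show ?thesis by simp
qed

lemma expectation_complex_mult_mds:
  fixes G :: "'a \<Rightarrow> complex"
  assumes X: "bounded_mds L X" and G: "G \<in> borel_measurable (F k)"
    and bd: "\<And>\<omega>. \<omega> \<in> space M \<Longrightarrow> cmod (G \<omega>) \<le> B"
  shows "(\<integral>\<omega>. G \<omega> * of_real (X k \<omega>) \<partial>M) = 0"
proof -
  note m[measurable] = bounded_mdsD(2)[OF X] measurable_F[OF G]
  have int: "integrable M (\<lambda>\<omega>. G \<omega> * of_real (X k \<omega>))"
  proof (rule integrable_bounded[where B="B * L"])
    fix \<omega> assume "\<omega> \<in> space M"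
    from bd[OF this] bounded_mdsD(3)[OF X this, of k]
    show "norm (G \<omega> * of_real (X k \<omega>)) \<le> B * L"
      unfolding norm_mult by (intro mult_mono) (auto intro: order_trans[OF norm_ge_zero])
  qed simp
  have "(\<integral>\<omega>. Re (G \<omega>) * X k \<omega> \<partial>M) = 0"
    using G bd by (intro expectation_mult_mds[OF X, where B=B]) (auto intro: order_trans[OF abs_Re_le_cmod])
  moreover have "(\<integral>\<omega>. Im (G \<omega>) * X k \<omega> \<partial>M) = 0"
    using G bd by (intro expectation_mult_mds[OF X, where B=B]) (auto intro: order_trans[OF abs_Im_le_cmod])
  ultimately show ?thesis
    using int by (simp add: complex_eq_iff flip: integral_Re integral_Im)
qed

lemma weighted_sum_bounded:
  fixes d :: "nat \<Rightarrow> real"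
  assumes X: "bounded_mds L X" and "\<omega> \<in> space M"
  shows "\<bar>\<Sum>k<t. d k * X k \<omega>\<bar> \<le> (\<Sum>k<t. \<bar>d k\<bar> * L)"
  using bounded_mdsD(3)[OF assms]
  by (intro order_trans[OF sum_abs] sum_mono) (auto simp: abs_mult intro!: mult_left_mono)

text \<open>Martingale differences are orthogonal, so the second moments of the summands add up.\<close>

lemma expectation_weighted_sum_square_le:
  assumes X: "bounded_mds L X"
  shows "(\<integral>\<omega>. (\<Sum>k<t. d k * X k \<omega>)\<^sup>2 \<partial>M) \<le> L\<^sup>2 * (\<Sum>k<t. (d k)\<^sup>2)"
proof (induction t)
  case 0 then show ?case by simp
next
  case (Suc t)
  define S where "S \<omega> = (\<Sum>k<t. d k * X k \<omega>)" for \<omega>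
  define B where "B = (\<Sum>k<t. \<bar>d k\<bar> * L)"
  note m[measurable] = bounded_mdsD(2)[OF X]
  have Sm: "S \<in> borel_measurable (F t)"
    unfolding S_def using bounded_mdsD(1)[OF X] by (intro borel_measurable_sum borel_measurable_times) auto
  note [measurable] = measurable_F[OF Sm]
  have SB: "\<bar>S \<omega>\<bar> \<le> B" if "\<omega> \<in> space M" for \<omega>
    unfolding S_def B_def by (rule weighted_sum_bounded[OF X that])
  have XB: "\<bar>X t \<omega>\<bar> \<le> L" if "\<omega> \<in> space M" for \<omega> by (rule bounded_mdsD(3)[OF X that])
  have XX: "(X t \<omega>)\<^sup>2 \<le> L\<^sup>2" if "\<omega> \<in> space M" for \<omega>
    using power_mono[OF XB[OF that], of 2] by simp
  have i1: "integrable M (\<lambda>\<omega>. (S \<omega>)\<^sup>2)"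
    using power_mono[OF SB, of _ 2] by (intro integrable_bounded[where B="B\<^sup>2"]) auto
  have i2: "integrable M (\<lambda>\<omega>. S \<omega> * X t \<omega>)"
  proof (rule integrable_bounded[where B="B * L"])
    fix \<omega> assume w: "\<omega> \<in> space M"
    show "norm (S \<omega> * X t \<omega>) \<le> B * L"
      unfolding norm_mult using SB[OF w] XB[OF w] by (intro mult_mono) auto
  qed simp
  have i3: "integrable M (\<lambda>\<omega>. (X t \<omega>)\<^sup>2)"
    using XX by (intro integrable_bounded[where B="L\<^sup>2"]) auto
  have "(\<integral>\<omega>. (X t \<omega>)\<^sup>2 \<partial>M) \<le> (\<integral>\<omega>. L\<^sup>2 \<partial>M)"
    using i3 XX by (intro integral_mono) auto
  then have "(\<integral>\<omega>. (X t \<omega>)\<^sup>2 \<partial>M) \<le> L\<^sup>2" by (simp add: prob_space)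
  have "(\<integral>\<omega>. (\<Sum>k<Suc t. d k * X k \<omega>)\<^sup>2 \<partial>M)
      = (\<integral>\<omega>. (S \<omega>)\<^sup>2 + 2 * d t * (S \<omega> * X t \<omega>) + (d t)\<^sup>2 * (X t \<omega>)\<^sup>2 \<partial>M)"
    by (simp add: S_def power2_eq_square algebra_simps)
  also have "\<dots> = (\<integral>\<omega>. (S \<omega>)\<^sup>2 \<partial>M) + 2 * d t * (\<integral>\<omega>. S \<omega> * X t \<omega> \<partial>M) + (d t)\<^sup>2 * (\<integral>\<omega>. (X t \<omega>)\<^sup>2 \<partial>M)"
    using i1 i2 i3 by simp
  also have "(\<integral>\<omega>. S \<omega> * X t \<omega> \<partial>M) = 0"
    by (rule expectation_mult_mds[OF X Sm SB])
  also have "(d t)\<^sup>2 * (\<integral>\<omega>. (X t \<omega>)\<^sup>2 \<partial>M) \<le> (d t)\<^sup>2 * L\<^sup>2"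
    using \<open>_ \<le> L\<^sup>2\<close> by (intro mult_left_mono) auto
  finally show ?case using Suc.IH by (simp add: S_def algebra_simps)
qed

lemma expectation_abs_weighted_sum_le:
  assumes X: "bounded_mds L X"
  shows "(\<integral>\<omega>. \<bar>\<Sum>k<t. d k * X k \<omega>\<bar> \<partial>M) \<le> L * sqrt (\<Sum>k<t. (d k)\<^sup>2)"
proof -
  note m[measurable] = bounded_mdsD(2)[OF X]
  note b = weighted_sum_bounded[OF X, of _ d t]
  have "(\<integral>\<omega>. \<bar>\<Sum>k<t. d k * X k \<omega>\<bar> \<partial>M) \<le> sqrt (\<integral>\<omega>. (\<Sum>k<t. d k * X k \<omega>)\<^sup>2 \<partial>M)"
  proof (rule expectation_abs_le_sqrt)
    show "integrable M (\<lambda>\<omega>. \<Sum>k<t. d k * X k \<omega>)"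
      using b by (intro integrable_bounded[where B="\<Sum>k<t. \<bar>d k\<bar> * L"]) auto
    show "integrable M (\<lambda>\<omega>. (\<Sum>k<t. d k * X k \<omega>)\<^sup>2)"
      using power_mono[OF b, of _ 2]
      by (intro integrable_bounded[where B="(\<Sum>k<t. \<bar>d k\<bar> * L)\<^sup>2"]) auto
  qed
  also have "\<dots> \<le> sqrt (L\<^sup>2 * (\<Sum>k<t. (d k)\<^sup>2))"
    by (intro real_sqrt_le_mono expectation_weighted_sum_square_le[OF X])
  finally show ?thesis using bounded_mdsD(4)[OF X] by (simp add: real_sqrt_mult)
qed

section \<open>A stable central limit theorem for weighted martingale differences\<close>

text \<open>A version of the conditional expectation of a \<open>[-1, 1]\<close>-valued variable that lies in \<open>[-1, 1]\<close>
  everywhere, and not just almost everywhere.\<close>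

definition clipped_cond_exp :: "nat \<Rightarrow> ('a \<Rightarrow> real) \<Rightarrow> 'a \<Rightarrow> real" where
  "clipped_cond_exp s W \<omega> = max (-1) (min 1 (real_cond_exp M (F s) W \<omega>))"

lemma clipped_cond_exp_measurable: "clipped_cond_exp s W \<in> borel_measurable (F s)"
  unfolding clipped_cond_exp_def[abs_def] by measurable

lemma abs_clipped_cond_exp_le: "\<bar>clipped_cond_exp s W \<omega>\<bar> \<le> 1"
  by (auto simp: clipped_cond_exp_def)

lemma expectation_mult_clipped_cond_exp:
  fixes G :: "'a \<Rightarrow> real"
  assumes W [measurable]: "W \<in> borel_measurable M" and Wb: "\<And>\<omega>. \<omega> \<in> space M \<Longrightarrow> \<bar>W \<omega>\<bar> \<le> 1"
    and G: "G \<in> borel_measurable (F s)" and bd: "\<And>\<omega>. \<omega> \<in> space M \<Longrightarrow> \<bar>G \<omega>\<bar> \<le> B"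
  shows "(\<integral>\<omega>. G \<omega> * clipped_cond_exp s W \<omega> \<partial>M) = (\<integral>\<omega>. G \<omega> * W \<omega> \<partial>M)"
proof -
  note [measurable] = measurable_F[OF G] measurable_F[OF clipped_cond_exp_measurable]
  have W_int: "integrable M W" using Wb by (intro integrable_bounded[where B=1]) auto
  have "AE \<omega> in M. -1 \<le> W \<omega>" "AE \<omega> in M. W \<omega> \<le> 1" using Wb by fastforce+
  then have "AE \<omega> in M. -1 \<le> real_cond_exp M (F s) W \<omega>" "AE \<omega> in M. real_cond_exp M (F s) W \<omega> \<le> 1"
    using cond.real_cond_exp_ge_c[OF W_int] cond.real_cond_exp_le_c[OF W_int] by auto
  then have "(\<integral>\<omega>. G \<omega> * clipped_cond_exp s W \<omega> \<partial>M) = (\<integral>\<omega>. G \<omega> * real_cond_exp M (F s) W \<omega> \<partial>M)"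
    by (intro integral_cong_AE) (auto simp: clipped_cond_exp_def)
  also have "\<dots> = (\<integral>\<omega>. G \<omega> * W \<omega> \<partial>M)"
  proof (rule cond.real_cond_exp_intg(2)[OF _ G W])
    show "integrable M (\<lambda>\<omega>. G \<omega> * W \<omega>)"
    proof (rule integrable_bounded[where B="B * 1"])
      fix \<omega> assume w: "\<omega> \<in> space M"
      show "norm (G \<omega> * W \<omega>) \<le> B * 1"
        unfolding norm_mult using bd[OF w] Wb[OF w] by (intro mult_mono) auto
    qed simp
  qed
  finally show ?thesis .
qed

lemma expectation_complex_mult_clipped_cond_exp:
  fixes G :: "'a \<Rightarrow> complex"
  assumes W [measurable]: "W \<in> borel_measurable M" and Wb: "\<And>\<omega>. \<omega> \<in> space M \<Longrightarrow> \<bar>W \<omega>\<bar> \<le> 1"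
    and G: "G \<in> borel_measurable (F s)" and bd: "\<And>\<omega>. \<omega> \<in> space M \<Longrightarrow> cmod (G \<omega>) \<le> B"
  shows "(\<integral>\<omega>. G \<omega> * of_real (clipped_cond_exp s W \<omega>) \<partial>M) = (\<integral>\<omega>. G \<omega> * of_real (W \<omega>) \<partial>M)"
proof -
  note [measurable] = measurable_F[OF G] measurable_F[OF clipped_cond_exp_measurable]
  have int: "integrable M (\<lambda>\<omega>. G \<omega> * of_real (H \<omega>))"
    if [measurable]: "H \<in> borel_measurable M" and Hb: "\<And>\<omega>. \<omega> \<in> space M \<Longrightarrow> \<bar>H \<omega>\<bar> \<le> 1" for H
  proof (rule integrable_bounded[where B="B * 1"])
    fix \<omega> assume w: "\<omega> \<in> space M"
    show "norm (G \<omega> * of_real (H \<omega>)) \<le> B * 1"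
      unfolding norm_mult using bd[OF w] Hb[OF w]
      by (intro mult_mono) (auto intro: order_trans[OF norm_ge_zero])
  qed simp
  have "(\<integral>\<omega>. Re (G \<omega>) * clipped_cond_exp s W \<omega> \<partial>M) = (\<integral>\<omega>. Re (G \<omega>) * W \<omega> \<partial>M)"
    using G bd by (intro expectation_mult_clipped_cond_exp[OF W Wb, where B=B]) (auto intro: order_trans[OF abs_Re_le_cmod])
  moreover have "(\<integral>\<omega>. Im (G \<omega>) * clipped_cond_exp s W \<omega> \<partial>M) = (\<integral>\<omega>. Im (G \<omega>) * W \<omega> \<partial>M)"
    using G bd by (intro expectation_mult_clipped_cond_exp[OF W Wb, where B=B]) (auto intro: order_trans[OF abs_Im_le_cmod])
  ultimately show ?thesis
    using int[OF W Wb] int[of "clipped_cond_exp s W"] abs_clipped_cond_exp_le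
    by (simp add: complex_eq_iff flip: integral_Re integral_Im)
qed

text \<open>A bounded adapted sequence \<open>T\<close> that converges to 1 when tested against variables known at some
  finite time does so when tested against every bounded \<open>W\<close>. Testing \<open>T t\<close> against \<open>W\<close> is the same
  as testing it against \<open>V t = E (W | F t)\<close>. For \<open>s \<le> t\<close>, replacing \<open>V t\<close> by \<open>V s\<close> costs at most
  \<open>K * sqrt (E (V t)\<^sup>2 - E (V s)\<^sup>2)\<close> by orthogonality of the increments of \<open>V\<close>, and the second
  moments are nondecreasing and bounded, hence Cauchy. So \<open>W\<close> need not be measurable with respect
  to the filtration, which is what turns convergence in law into stable convergence.\<close>

lemma expectation_mult_tendsto_of_adapted:
  fixes T :: "nat \<Rightarrow> 'a \<Rightarrow> complex"
  assumes W [measurable]: "W \<in> borel_measurable M" and Wb: "\<And>\<omega>. \<omega> \<in> space M \<Longrightarrow> \<bar>W \<omega>\<bar> \<le> 1"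
    and T: "\<And>t. T t \<in> borel_measurable (F t)" and Tb: "\<And>t \<omega>. \<omega> \<in> space M \<Longrightarrow> cmod (T t \<omega>) \<le> K"
    and lim: "\<And>s G. G \<in> borel_measurable (F s) \<Longrightarrow> (\<And>\<omega>. \<bar>G \<omega>\<bar> \<le> 1) \<Longrightarrow>
      (\<lambda>t. \<integral>\<omega>. T t \<omega> * of_real (G \<omega>) \<partial>M) \<longlonglongrightarrow> complex_of_real (\<integral>\<omega>. G \<omega> \<partial>M)"
  shows "(\<lambda>t. \<integral>\<omega>. T t \<omega> * of_real (W \<omega>) \<partial>M) \<longlonglongrightarrow> complex_of_real (\<integral>\<omega>. W \<omega> \<partial>M)"
proof -
  define V where "V s = clipped_cond_exp s W" for s
  have VF: "V s \<in> borel_measurable (F s)" for s unfolding V_def by (rule clipped_cond_exp_measurable)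
  note [measurable] = measurable_F[OF VF] measurable_F[OF T]
  have Vb: "\<bar>V s \<omega>\<bar> \<le> 1" for s \<omega> unfolding V_def by (rule abs_clipped_cond_exp_le)
  note V_int = expectation_mult_clipped_cond_exp[OF W Wb, folded V_def]
  have mult1: "\<bar>V s \<omega> * V t \<omega>\<bar> \<le> 1" for s t \<omega>
    using mult_mono[OF Vb[of s \<omega>] Vb[of t \<omega>]] by (simp add: abs_mult)
  have iVV: "integrable M (\<lambda>\<omega>. V s \<omega> * V t \<omega>)" for s t
    using mult1 by (intro integrable_bounded[where B=1]) auto
  have K: "0 \<le> K" using Tb not_empty norm_ge_zero order_trans by blast
  define e where "e s = (\<integral>\<omega>. (V s \<omega>)\<^sup>2 \<partial>M)" for s
  have diff: "(\<integral>\<omega>. (V t \<omega> - V s \<omega>)\<^sup>2 \<partial>M) = e t - e s" if "s \<le> t" for s t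
  proof -
    have "(\<integral>\<omega>. V s \<omega> * V t \<omega> \<partial>M) = (\<integral>\<omega>. V s \<omega> * W \<omega> \<partial>M)"
      using Vb by (intro V_int[where B=1] measurable_F_mono[OF VF that]) auto
    also have "\<dots> = (\<integral>\<omega>. V s \<omega> * V s \<omega> \<partial>M)"
      using Vb by (intro V_int[where B=1, symmetric] VF) auto
    finally have *: "(\<integral>\<omega>. V s \<omega> * V t \<omega> \<partial>M) = e s" by (simp add: e_def power2_eq_square)
    have "(\<integral>\<omega>. (V t \<omega> - V s \<omega>)\<^sup>2 \<partial>M) = (\<integral>\<omega>. V t \<omega> * V t \<omega> - 2 * (V s \<omega> * V t \<omega>) + V s \<omega> * V s \<omega> \<partial>M)"
      by (simp add: power2_eq_square algebra_simps)
    also have "\<dots> = e t - 2 * e s + e s"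
      using iVV by (simp add: * e_def power2_eq_square)
    finally show ?thesis by simp
  qed
  have "e s \<le> e t" if "s \<le> t" for s t
  proof -
    have "0 \<le> (\<integral>\<omega>. (V t \<omega> - V s \<omega>)\<^sup>2 \<partial>M)" by simp
    then show ?thesis unfolding diff[OF that] by simp
  qed
  then have "incseq e" by (simp add: incseq_def)
  moreover have "e s \<le> 1" for s
    unfolding e_def using iVV[of s s] mult1[of s _ s]
    by (intro integral_le_const) (auto simp: power2_eq_square)
  ultimately obtain E where E: "e \<longlonglongrightarrow> E" "\<And>s. e s \<le> E"
    by (metis incseq_convergent)
  show ?thesis
  proof (rule LIMSEQ_I)
    fix r :: real assume r: "0 < r"
    \<comment> \<open>With second moments this close, replacing \<open>V t\<close> by \<open>V s\<close> costs less than \<open>r / 2\<close>.\<close>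
    define \<delta> where "\<delta> = (r / (2 * (K + 1)))\<^sup>2"
    have "0 < \<delta>" using r K by (simp add: \<delta>_def)
    then obtain s where s: "E - e s < \<delta>" using LIMSEQ_D[OF E(1), of \<delta>] E(2) by fastforce
    have Tint: "integrable M (\<lambda>\<omega>. T t \<omega> * of_real (H \<omega>))"
      if [measurable]: "H \<in> borel_measurable M" and Hb: "\<And>\<omega>. \<omega> \<in> space M \<Longrightarrow> \<bar>H \<omega>\<bar> \<le> 1" for H t
    proof (rule integrable_bounded[where B="K * 1"])
      fix \<omega> assume w: "\<omega> \<in> space M"
      show "norm (T t \<omega> * of_real (H \<omega>)) \<le> K * 1"
        unfolding norm_mult using Tb[OF w] Hb[OF w] K by (intro mult_mono) auto
    qed simp
    have TV: "integrable M (\<lambda>\<omega>. T t \<omega> * of_real (V l \<omega>))" for t l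
      using Vb by (intro Tint) auto
    obtain n where n: "\<And>t. t \<ge> n \<Longrightarrow> cmod ((\<integral>\<omega>. T t \<omega> * of_real (V s \<omega>) \<partial>M) - (\<integral>\<omega>. V s \<omega> \<partial>M)) < r / 2"
      using LIMSEQ_D[OF lim[OF VF[of s] Vb], of "r / 2"] r by auto
    have mean: "(\<integral>\<omega>. V s \<omega> \<partial>M) = (\<integral>\<omega>. W \<omega> \<partial>M)"
      using V_int[of "\<lambda>_. 1" s 1] by simp
    show "\<exists>no. \<forall>t\<ge>no. norm ((\<integral>\<omega>. T t \<omega> * of_real (W \<omega>) \<partial>M) - complex_of_real (\<integral>\<omega>. W \<omega> \<partial>M)) < r"
    proof (intro exI allI impI)
      fix t assume t: "max n s \<le> t"
      have "(\<integral>\<omega>. T t \<omega> * of_real (W \<omega>) \<partial>M) = (\<integral>\<omega>. T t \<omega> * of_real (V t \<omega>) \<partial>M)"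
        unfolding V_def by (rule expectation_complex_mult_clipped_cond_exp[OF W Wb T Tb, symmetric])
      also have "\<dots> = (\<integral>\<omega>. T t \<omega> * of_real (V t \<omega> - V s \<omega>) \<partial>M) + (\<integral>\<omega>. T t \<omega> * of_real (V s \<omega>) \<partial>M)"
        using Bochner_Integration.integral_diff[OF TV[of t t] TV[of t s]]
        by (simp add: right_diff_distrib)
      finally have eq: "(\<integral>\<omega>. T t \<omega> * of_real (W \<omega>) \<partial>M) - complex_of_real (\<integral>\<omega>. W \<omega> \<partial>M)
          = (\<integral>\<omega>. T t \<omega> * of_real (V t \<omega> - V s \<omega>) \<partial>M) + ((\<integral>\<omega>. T t \<omega> * of_real (V s \<omega>) \<partial>M) - (\<integral>\<omega>. V s \<omega> \<partial>M))"
        by (simp add: mean)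
      have iV: "integrable M (V s)" for s using Vb by (intro integrable_bounded[where B=1]) auto
      have "cmod (\<integral>\<omega>. T t \<omega> * of_real (V t \<omega> - V s \<omega>) \<partial>M) \<le> (\<integral>\<omega>. K * \<bar>V t \<omega> - V s \<omega>\<bar> \<partial>M)"
      proof (rule norm_expectation_le)
        show "integrable M (\<lambda>\<omega>. T t \<omega> * of_real (V t \<omega> - V s \<omega>))"
          using Bochner_Integration.integrable_diff[OF TV[of t t] TV[of t s]]
          by (simp add: right_diff_distrib)
        show "integrable M (\<lambda>\<omega>. K * \<bar>V t \<omega> - V s \<omega>\<bar>)" using iV by simp
        show "norm (T t \<omega> * of_real (V t \<omega> - V s \<omega>)) \<le> K * \<bar>V t \<omega> - V s \<omega>\<bar>" if "\<omega> \<in> space M" for \<omega>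
          unfolding norm_mult norm_of_real by (intro mult_right_mono Tb that) simp
      qed
      also have "\<dots> = K * (\<integral>\<omega>. \<bar>V t \<omega> - V s \<omega>\<bar> \<partial>M)" by simp
      also have "\<dots> \<le> K * sqrt (e t - e s)"
      proof -
        have "s \<le> t" using t by simp
        have "integrable M (\<lambda>\<omega>. (V t \<omega> - V s \<omega>)\<^sup>2)"
          using iVV by (simp add: power2_eq_square algebra_simps)
        then have "(\<integral>\<omega>. \<bar>V t \<omega> - V s \<omega>\<bar> \<partial>M) \<le> sqrt (\<integral>\<omega>. (V t \<omega> - V s \<omega>)\<^sup>2 \<partial>M)"
          using iV by (intro expectation_abs_le_sqrt) auto
        then show ?thesis unfolding diff[OF \<open>s \<le> t\<close>] using K by (rule mult_left_mono)
      qed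
      also have "\<dots> \<le> K * sqrt \<delta>"
        using s E(2)[of t] K by (intro mult_left_mono real_sqrt_le_mono) auto
      also have "\<dots> \<le> r / 2"
      proof -
        have "K * (r / (2 * (K + 1))) \<le> r / 2" using K r by (simp add: field_simps)
        moreover have "sqrt \<delta> = r / (2 * (K + 1))"
          unfolding \<delta>_def real_sqrt_abs using K r by simp
        ultimately show ?thesis by simp
      qed
      finally show "norm ((\<integral>\<omega>. T t \<omega> * of_real (W \<omega>) \<partial>M) - complex_of_real (\<integral>\<omega>. W \<omega> \<partial>M)) < r"
        unfolding eq using n[of t] t by (intro norm_triangle_lt) auto
    qed
  qed
qed

text \<open>The McLeish product, a complex martingale in \<open>n\<close> with mean one.\<close>

definition mcleish_prod :: "real \<Rightarrow> (nat \<Rightarrow> real) \<Rightarrow> (nat \<Rightarrow> 'a \<Rightarrow> real) \<Rightarrow> nat \<Rightarrow> 'a \<Rightarrow> complex" where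
  "mcleish_prod u d X n \<omega> = (\<Prod>k<n. 1 + \<i> * complex_of_real (u * (d k * X k \<omega>)))"

lemma mcleish_prod_measurable:
  assumes "bounded_mds L X"
  shows "mcleish_prod u d X n \<in> borel_measurable (F n)"
  unfolding mcleish_prod_def[abs_def] using bounded_mdsD(1)[OF assms]
  by (intro borel_measurable_prod) (auto intro!: borel_measurable_add borel_measurable_times borel_measurable_of_real)

text \<open>A bound independent of \<open>\<omega>\<close>: for bounded differences the McLeish product is uniformly bounded as
  long as the sum of the squared weights is.\<close>

lemma cmod_mcleish_prod_le:
  assumes X: "bounded_mds L X" and w: "\<omega> \<in> space M"
  shows "cmod (mcleish_prod u d X n \<omega>) \<le> exp (u\<^sup>2 * L\<^sup>2 * (\<Sum>k<n. (d k)\<^sup>2) / 2)"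
proof -
  have "cmod (mcleish_prod u d X n \<omega>) \<le> (\<Prod>k<n. exp ((u * (d k * X k \<omega>))\<^sup>2 / 2))"
    unfolding mcleish_prod_def prod_norm[symmetric]
    by (intro prod_mono conjI norm_ge_zero norm_one_plus_i_le)
  also have "\<dots> \<le> (\<Prod>k<n. exp (u\<^sup>2 * L\<^sup>2 * (d k)\<^sup>2 / 2))"
  proof (intro prod_mono conjI)
    fix k
    have "(X k \<omega>)\<^sup>2 \<le> L\<^sup>2" using power_mono[OF bounded_mdsD(3)[OF X w, of k], of 2] by simp
    then have "(u * d k)\<^sup>2 * (X k \<omega>)\<^sup>2 \<le> (u * d k)\<^sup>2 * L\<^sup>2" by (intro mult_left_mono) auto
    then show "exp ((u * (d k * X k \<omega>))\<^sup>2 / 2) \<le> exp (u\<^sup>2 * L\<^sup>2 * (d k)\<^sup>2 / 2)"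
      by (simp add: power_mult_distrib mult_ac)
  qed simp
  also have "\<dots> = exp (u\<^sup>2 * L\<^sup>2 * (\<Sum>k<n. (d k)\<^sup>2) / 2)"
    by (simp add: exp_sum sum_distrib_left sum_divide_distrib)
  finally show ?thesis .
qed

lemma expectation_mcleish_prod:
  assumes X: "bounded_mds L X" and G: "G \<in> borel_measurable (F s)" and Gb: "\<And>\<omega>. \<bar>G \<omega>\<bar> \<le> (1::real)"
    and "s \<le> n"
  shows "(\<integral>\<omega>. mcleish_prod u d X n \<omega> * of_real (G \<omega>) \<partial>M) = (\<integral>\<omega>. mcleish_prod u d X s \<omega> * of_real (G \<omega>) \<partial>M)"
  using \<open>s \<le> n\<close>
proof (induction n rule: dec_induct)
  case base then show ?case ..
next
  case (step n)
  define P where "P \<omega> = mcleish_prod u d X n \<omega> * of_real (G \<omega>)" for \<omega>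
  define B where "B = exp (u\<^sup>2 * L\<^sup>2 * (\<Sum>k<n. (d k)\<^sup>2) / 2)"
  have PF: "P \<in> borel_measurable (F n)"
  proof -
    note [measurable] = mcleish_prod_measurable[OF X, of u d n] measurable_F_mono[OF G step(1)]
    show ?thesis unfolding P_def by measurable
  qed
  note [measurable] = measurable_F[OF PF] bounded_mdsD(2)[OF X]
  have PB: "cmod (P \<omega>) \<le> B" if w: "\<omega> \<in> space M" for \<omega>
    using mult_mono[OF cmod_mcleish_prod_le[OF X w, of u d n] Gb[of \<omega>]]
    by (simp add: P_def norm_mult B_def)
  have int: "integrable M P" using PB by (intro integrable_bounded) auto
  have int': "integrable M (\<lambda>\<omega>. P \<omega> * of_real (X n \<omega>))"
  proof (rule integrable_bounded[where B="B * L"])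
    fix \<omega> assume w: "\<omega> \<in> space M"
    show "norm (P \<omega> * of_real (X n \<omega>)) \<le> B * L"
      unfolding norm_mult using PB[OF w] bounded_mdsD(3)[OF X w, of n]
      by (intro mult_mono) (auto intro: order_trans[OF norm_ge_zero])
  qed simp
  have "(\<integral>\<omega>. mcleish_prod u d X (Suc n) \<omega> * of_real (G \<omega>) \<partial>M)
      = (\<integral>\<omega>. P \<omega> + (\<i> * of_real (u * d n)) * (P \<omega> * of_real (X n \<omega>)) \<partial>M)"
    by (simp add: mcleish_prod_def P_def algebra_simps)
  also have "\<dots> = (\<integral>\<omega>. P \<omega> \<partial>M) + (\<i> * of_real (u * d n)) * (\<integral>\<omega>. P \<omega> * of_real (X n \<omega>) \<partial>M)"
    using int int' by simp
  also have "(\<integral>\<omega>. P \<omega> * of_real (X n \<omega>) \<partial>M) = 0"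
    by (rule expectation_complex_mult_mds[OF X PF PB])
  finally show ?case using step.IH by (simp add: P_def)
qed

text \<open>Against a variable known at time \<open>s\<close>, the product over \<open>k < t\<close> may be truncated to \<open>k < s\<close> by the
  martingale property, and a product of a fixed number of factors tends to 1.\<close>

lemma expectation_mult_mcleish_prod_tendsto:
  assumes X: "bounded_mds L X"
    and C: "\<And>t. (\<Sum>k<t. (c t k)\<^sup>2) \<le> C"
    and c: "\<And>t k. \<bar>c t k\<bar> \<le> e t" and e: "e \<longlonglongrightarrow> 0"
    and W: "W \<in> borel_measurable M" "\<And>\<omega>. \<omega> \<in> space M \<Longrightarrow> \<bar>W \<omega>\<bar> \<le> 1"
  shows "(\<lambda>t. \<integral>\<omega>. mcleish_prod u (c t) X t \<omega> * of_real (W \<omega>) \<partial>M) \<longlonglongrightarrow> complex_of_real (\<integral>\<omega>. W \<omega> \<partial>M)"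
proof (rule expectation_mult_tendsto_of_adapted[OF W])
  show "mcleish_prod u (c t) X t \<in> borel_measurable (F t)" for t
    by (rule mcleish_prod_measurable[OF X])
  show "cmod (mcleish_prod u (c t) X t \<omega>) \<le> exp (u\<^sup>2 * L\<^sup>2 * C / 2)" if "\<omega> \<in> space M" for t \<omega>
    using mult_left_mono[OF C[of t], of "u\<^sup>2 * L\<^sup>2"]
    by (intro order_trans[OF cmod_mcleish_prod_le[OF X that]]) simp
  fix s and G :: "'a \<Rightarrow> real"
  assume G: "G \<in> borel_measurable (F s)" and Gb: "\<And>\<omega>. \<bar>G \<omega>\<bar> \<le> 1"
  note [measurable] = measurable_F[OF G] measurable_F[OF mcleish_prod_measurable[OF X]]
  obtain E where E: "\<And>t. \<bar>e t\<bar> \<le> E"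
    using convergent_imp_Bseq[OF convergentI[OF e]] by (auto simp: Bseq_def)
  have "(\<lambda>t. \<integral>\<omega>. mcleish_prod u (c t) X s \<omega> * of_real (G \<omega>) \<partial>M) \<longlonglongrightarrow> (\<integral>\<omega>. of_real (G \<omega>) \<partial>M)"
  proof (rule integral_dominated_convergence[where w="\<lambda>_. exp (u\<^sup>2 * L\<^sup>2 * (\<Sum>k<s. E\<^sup>2) / 2)"])
    show "AE \<omega> in M. (\<lambda>t. mcleish_prod u (c t) X s \<omega> * of_real (G \<omega>)) \<longlonglongrightarrow> of_real (G \<omega>)"
    proof (rule AE_I2)
      fix \<omega> assume "\<omega> \<in> space M"
      have "(\<lambda>t. c t k) \<longlonglongrightarrow> 0" for k
        by (rule Lim_null_comparison[OF _ e]) (simp add: c)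
      then have "(\<lambda>t. mcleish_prod u (c t) X s \<omega> * of_real (G \<omega>))
          \<longlonglongrightarrow> (\<Prod>k<s. 1 + \<i> * complex_of_real (u * (0 * X k \<omega>))) * of_real (G \<omega>)"
        unfolding mcleish_prod_def by (intro tendsto_intros)
      then show "(\<lambda>t. mcleish_prod u (c t) X s \<omega> * of_real (G \<omega>)) \<longlonglongrightarrow> of_real (G \<omega>)" by simp
    qed
    fix t
    show "AE \<omega> in M. norm (mcleish_prod u (c t) X s \<omega> * of_real (G \<omega>)) \<le> exp (u\<^sup>2 * L\<^sup>2 * (\<Sum>k<s. E\<^sup>2) / 2)"
    proof (rule AE_I2)
      fix \<omega> assume w: "\<omega> \<in> space M"
      have "\<bar>c t k\<bar> \<le> \<bar>E\<bar>" for k using c[of t k] E[of t] by linarith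
      then have "(\<Sum>k<s. (c t k)\<^sup>2) \<le> (\<Sum>k<s. E\<^sup>2)" by (intro sum_mono) (simp add: abs_le_square_iff)
      then have "u\<^sup>2 * L\<^sup>2 * (\<Sum>k<s. (c t k)\<^sup>2) \<le> u\<^sup>2 * L\<^sup>2 * (\<Sum>k<s. E\<^sup>2)" by (intro mult_left_mono) auto
      then have "cmod (mcleish_prod u (c t) X s \<omega>) \<le> exp (u\<^sup>2 * L\<^sup>2 * (\<Sum>k<s. E\<^sup>2) / 2)"
        by (intro order_trans[OF cmod_mcleish_prod_le[OF X w]]) simp
      from mult_mono[OF this Gb[of \<omega>]] show "norm (mcleish_prod u (c t) X s \<omega> * of_real (G \<omega>)) \<le> exp (u\<^sup>2 * L\<^sup>2 * (\<Sum>k<s. E\<^sup>2) / 2)"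
        by (simp add: norm_mult)
    qed
  qed simp_all
  moreover have "\<forall>\<^sub>F t in sequentially. (\<integral>\<omega>. mcleish_prod u (c t) X s \<omega> * of_real (G \<omega>) \<partial>M)
      = (\<integral>\<omega>. mcleish_prod u (c t) X t \<omega> * of_real (G \<omega>) \<partial>M)"
    by (intro eventually_sequentiallyI[of s] expectation_mcleish_prod[OF X G Gb, symmetric])
  ultimately show "(\<lambda>t. \<integral>\<omega>. mcleish_prod u (c t) X t \<omega> * of_real (G \<omega>) \<partial>M) \<longlonglongrightarrow> complex_of_real (\<integral>\<omega>. G \<omega> \<partial>M)"
    by (auto elim: Lim_transform_eventually)
qed

text \<open>The difference splits into three parts: the weighted sum of the martingale differences
  \<open>(X k)\<^sup>2 - v k\<close>, small in \<open>L\<^sup>2\<close> because its second moment is at most a multiple of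
  the sum of the fourth powers of the weights; a weighted average of \<open>v k - V\<close>, small in \<open>L\<^sup>1\<close> by
  the Toeplitz lemma; and the defect of the total weight.\<close>

lemma quadratic_variation_tendsto:
  assumes X: "bounded_mds L X"
    and v: "bounded_mds L' (\<lambda>k \<omega>. (X k \<omega>)\<^sup>2 - v k \<omega>)"
    and vV: "(\<lambda>k. \<integral>\<omega>. \<bar>v k \<omega> - V \<omega>\<bar> \<partial>M) \<longlonglongrightarrow> 0"
    and V: "integrable M V"
    and c: "\<And>t k. \<bar>c t k\<bar> \<le> e t" and e: "e \<longlonglongrightarrow> 0"
    and \<tau>: "(\<lambda>t. \<Sum>k<t. (c t k)\<^sup>2) \<longlonglongrightarrow> \<tau>"
  shows "(\<lambda>t. \<integral>\<omega>. \<bar>(\<Sum>k<t. (c t k)\<^sup>2 * (X k \<omega>)\<^sup>2) - \<tau> * V \<omega>\<bar> \<partial>M) \<longlonglongrightarrow> 0"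
proof -
  define \<eta> where "\<eta> k \<omega> = (X k \<omega>)\<^sup>2 - v k \<omega>" for k \<omega>
  define C where "C t = (\<Sum>k<t. (c t k)\<^sup>2)" for t
  define d where "d k = (\<integral>\<omega>. \<bar>v k \<omega> - V \<omega>\<bar> \<partial>M)" for k
  have \<eta>: "bounded_mds L' \<eta>" using v unfolding \<eta>_def[abs_def] .
  have iX: "integrable M (\<lambda>\<omega>. (X k \<omega>)\<^sup>2)" for k
    using bounded_mdsD(2)[OF X] power_mono[OF bounded_mdsD(3)[OF X, of _ k], where n=2]
    by (intro integrable_bounded[where B="L\<^sup>2"]) auto
  have i\<eta>: "integrable M (\<eta> k)" for k
    using bounded_mdsD(2,3)[OF \<eta>] by (intro integrable_bounded[where B=L']) auto
  have "integrable M (\<lambda>\<omega>. (X k \<omega>)\<^sup>2 - \<eta> k \<omega>)" for k using iX i\<eta> by simp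
  then have iv: "integrable M (v k)" for k by (simp add: \<eta>_def)
  have bound: "(\<integral>\<omega>. \<bar>(\<Sum>k<t. (c t k)\<^sup>2 * (X k \<omega>)\<^sup>2) - \<tau> * V \<omega>\<bar> \<partial>M)
      \<le> L' * sqrt ((e t)\<^sup>2 * C t) + (\<Sum>k<t. (c t k)\<^sup>2 * d k) + \<bar>C t - \<tau>\<bar> * (\<integral>\<omega>. \<bar>V \<omega>\<bar> \<partial>M)" for t
  proof -
    have "(\<integral>\<omega>. \<bar>(\<Sum>k<t. (c t k)\<^sup>2 * (X k \<omega>)\<^sup>2) - \<tau> * V \<omega>\<bar> \<partial>M)
      \<le> (\<integral>\<omega>. \<bar>\<Sum>k<t. (c t k)\<^sup>2 * \<eta> k \<omega>\<bar> + (\<Sum>k<t. (c t k)\<^sup>2 * \<bar>v k \<omega> - V \<omega>\<bar>) + \<bar>C t - \<tau>\<bar> * \<bar>V \<omega>\<bar> \<partial>M)"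
    proof (rule integral_mono)
      fix \<omega>
      have "(\<Sum>k<t. (c t k)\<^sup>2 * (X k \<omega>)\<^sup>2) - \<tau> * V \<omega>
          = (\<Sum>k<t. (c t k)\<^sup>2 * \<eta> k \<omega>) + (\<Sum>k<t. (c t k)\<^sup>2 * (v k \<omega> - V \<omega>)) + (C t - \<tau>) * V \<omega>"
        by (simp add: \<eta>_def C_def algebra_simps sum.distrib sum_subtractf sum_distrib_left)
      moreover have "\<bar>\<Sum>k<t. (c t k)\<^sup>2 * (v k \<omega> - V \<omega>)\<bar> \<le> (\<Sum>k<t. (c t k)\<^sup>2 * \<bar>v k \<omega> - V \<omega>\<bar>)"
        by (rule order_trans[OF sum_abs]) (simp add: abs_mult)
      ultimately show "\<bar>(\<Sum>k<t. (c t k)\<^sup>2 * (X k \<omega>)\<^sup>2) - \<tau> * V \<omega>\<bar>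
          \<le> \<bar>\<Sum>k<t. (c t k)\<^sup>2 * \<eta> k \<omega>\<bar> + (\<Sum>k<t. (c t k)\<^sup>2 * \<bar>v k \<omega> - V \<omega>\<bar>) + \<bar>C t - \<tau>\<bar> * \<bar>V \<omega>\<bar>"
        unfolding abs_mult[symmetric] by linarith
    qed (use iX i\<eta> iv V in auto)
    also have "\<dots> = (\<integral>\<omega>. \<bar>\<Sum>k<t. (c t k)\<^sup>2 * \<eta> k \<omega>\<bar> \<partial>M) + (\<Sum>k<t. (c t k)\<^sup>2 * d k) + \<bar>C t - \<tau>\<bar> * (\<integral>\<omega>. \<bar>V \<omega>\<bar> \<partial>M)"
      using i\<eta> iv V by (simp add: d_def)
    also have "(\<integral>\<omega>. \<bar>\<Sum>k<t. (c t k)\<^sup>2 * \<eta> k \<omega>\<bar> \<partial>M) \<le> L' * sqrt (\<Sum>k<t. ((c t k)\<^sup>2)\<^sup>2)"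
      by (rule expectation_abs_weighted_sum_le[OF \<eta>])
    also have "L' * sqrt (\<Sum>k<t. ((c t k)\<^sup>2)\<^sup>2) \<le> L' * sqrt ((e t)\<^sup>2 * C t)"
    proof (intro mult_left_mono real_sqrt_le_mono bounded_mdsD(4)[OF \<eta>])
      have "(c t k)\<^sup>2 \<le> (e t)\<^sup>2" for k using power_mono[OF c[of t k], of 2] by simp
      then show "(\<Sum>k<t. ((c t k)\<^sup>2)\<^sup>2) \<le> (e t)\<^sup>2 * C t"
        unfolding C_def sum_distrib_left power2_eq_square[of "(c _ _)\<^sup>2"]
        by (intro sum_mono mult_right_mono) auto
    qed
    finally show ?thesis by simp
  qed
  obtain K where K: "\<And>t. C t \<le> K"
    using convergent_imp_Bseq[OF convergentI[OF \<tau>]] unfolding Bseq_def C_def by (auto simp: abs_le_iff)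
  have c0: "(\<lambda>t. c t k) \<longlonglongrightarrow> 0" for k by (rule Lim_null_comparison[OF _ e]) (simp add: c)
  have C: "C \<longlonglongrightarrow> \<tau>" using \<tau> by (simp add: C_def[abs_def])
  have "(\<lambda>t. (c t k)\<^sup>2) \<longlonglongrightarrow> 0" for k using tendsto_power[OF c0, where n=2] by simp
  then have "(\<lambda>t. \<Sum>k<t. (c t k)\<^sup>2 * d k) \<longlonglongrightarrow> 0"
    using K vV by (intro weighted_average_tendsto_0[where C=K]) (simp_all add: C_def d_def[abs_def])
  then have "(\<lambda>t. L' * sqrt ((e t)\<^sup>2 * C t) + (\<Sum>k<t. (c t k)\<^sup>2 * d k) + \<bar>C t - \<tau>\<bar> * (\<integral>\<omega>. \<bar>V \<omega>\<bar> \<partial>M))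
      \<longlonglongrightarrow> L' * sqrt (0\<^sup>2 * \<tau>) + 0 + \<bar>\<tau> - \<tau>\<bar> * (\<integral>\<omega>. \<bar>V \<omega>\<bar> \<partial>M)"
    by (intro tendsto_add tendsto_mult tendsto_const tendsto_real_sqrt tendsto_power tendsto_rabs tendsto_diff C e)
  then have lim: "(\<lambda>t. L' * sqrt ((e t)\<^sup>2 * C t) + (\<Sum>k<t. (c t k)\<^sup>2 * d k) + \<bar>C t - \<tau>\<bar> * (\<integral>\<omega>. \<bar>V \<omega>\<bar> \<partial>M))
      \<longlonglongrightarrow> 0" by simp
  show ?thesis
    by (rule tendsto_sandwich[OF always_eventually always_eventually tendsto_const lim]) (simp_all add: bound)
qed

text \<open>All factors of both products lie in the closed unit disc, so the distance of the products is at
  most the sum of the distances of their factors.\<close>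

lemma iexp_sum_approx:
  assumes X: "bounded_mds L X" and w: "\<omega> \<in> space M" and d: "\<And>k. \<bar>d k\<bar> \<le> e"
  shows "cmod (iexp (u * (\<Sum>k<t. d k * X k \<omega>))
      - mcleish_prod u d X t \<omega> * of_real (exp (- (u\<^sup>2 / 2) * (\<Sum>k<t. (d k)\<^sup>2 * (X k \<omega>)\<^sup>2))))
    \<le> 2 * \<bar>u\<bar>^3 * L^3 * e * (\<Sum>k<t. (d k)\<^sup>2)"
proof -
  define x where "x k = u * (d k * X k \<omega>)" for k
  have "iexp (u * (\<Sum>k<t. d k * X k \<omega>)) = (\<Prod>k<t. iexp (x k))"
    by (simp add: x_def exp_sum sum_distrib_left)
  moreover have "mcleish_prod u d X t \<omega> * of_real (exp (- (u\<^sup>2 / 2) * (\<Sum>k<t. (d k)\<^sup>2 * (X k \<omega>)\<^sup>2)))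
      = (\<Prod>k<t. (1 + \<i> * x k) * of_real (exp (- (x k)\<^sup>2 / 2)))"
  proof -
    have "- (u\<^sup>2 / 2) * (\<Sum>k<t. (d k)\<^sup>2 * (X k \<omega>)\<^sup>2) = (\<Sum>k<t. - (x k)\<^sup>2 / 2)"
      unfolding sum_distrib_left x_def by (intro sum.cong) (auto simp: power_mult_distrib)
    then show ?thesis
      by (simp add: mcleish_prod_def exp_sum prod.distrib flip: x_def)
  qed
  ultimately have "cmod (iexp (u * (\<Sum>k<t. d k * X k \<omega>))
      - mcleish_prod u d X t \<omega> * of_real (exp (- (u\<^sup>2 / 2) * (\<Sum>k<t. (d k)\<^sup>2 * (X k \<omega>)\<^sup>2))))
    \<le> (\<Sum>k<t. cmod (iexp (x k) - (1 + \<i> * x k) * of_real (exp (- (x k)\<^sup>2 / 2))))"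
    using norm_mcleish_factor by (simp only:) (intro norm_prod_diff, auto)
  also have "\<dots> \<le> (\<Sum>k<t. 2 * \<bar>u\<bar>^3 * L^3 * e * (d k)\<^sup>2)"
  proof (rule sum_mono)
    fix k
    have "\<bar>x k\<bar>^3 = \<bar>u\<bar>^3 * \<bar>X k \<omega>\<bar>^3 * (\<bar>d k\<bar> * (d k)\<^sup>2)"
      unfolding power2_abs[of "d k", symmetric]
      by (simp only: x_def abs_mult power3_eq_cube power2_eq_square mult_ac)
    also have "\<dots> \<le> \<bar>u\<bar>^3 * L^3 * (e * (d k)\<^sup>2)"
    proof -
      have "\<bar>X k \<omega>\<bar>^3 \<le> L^3" by (intro power_mono bounded_mdsD(3)[OF X w]) simp
      then have "\<bar>u\<bar>^3 * \<bar>X k \<omega>\<bar>^3 \<le> \<bar>u\<bar>^3 * L^3" by (rule mult_left_mono) simp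
      moreover have "\<bar>d k\<bar> * (d k)\<^sup>2 \<le> e * (d k)\<^sup>2" by (intro mult_right_mono d) simp
      ultimately show ?thesis by (rule mult_mono) (use bounded_mdsD(4)[OF X] in auto)
    qed
    finally show "cmod (iexp (x k) - (1 + \<i> * x k) * of_real (exp (- (x k)\<^sup>2 / 2))) \<le> 2 * \<bar>u\<bar>^3 * L^3 * e * (d k)\<^sup>2"
      using iexp_second_order[of "x k"] by simp
  qed
  finally show ?thesis by (simp add: sum_distrib_left)
qed

text \<open>Here \<open>v k\<close> plays the role of the conditional variance of \<open>X k\<close>, which is why \<open>(X k)\<^sup>2 - v k\<close> is
  required to be a martingale difference. The uniform bound \<open>e\<close> on the weights takes the place of a Lindeberg condition.\<close>

lemma stable_martingale_clt:
  assumes X: "bounded_mds L X"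
    and v: "bounded_mds L' (\<lambda>k \<omega>. (X k \<omega>)\<^sup>2 - v k \<omega>)"
    and vV: "(\<lambda>k. \<integral>\<omega>. \<bar>v k \<omega> - V \<omega>\<bar> \<partial>M) \<longlonglongrightarrow> 0"
    and V: "integrable M V"
    and c: "\<And>t k. \<bar>c t k\<bar> \<le> e t" and e: "e \<longlonglongrightarrow> 0"
    and \<tau>: "(\<lambda>t. \<Sum>k<t. (c t k)\<^sup>2) \<longlonglongrightarrow> \<tau>"
  shows "converges_stably M (\<lambda>t \<omega>. \<Sum>k<t. c t k * X k \<omega>) (gaussian_kernel (\<lambda>\<omega>. \<tau> * V \<omega>))"
proof (rule converges_stably_gaussianI)
  note [measurable] = bounded_mdsD(2)[OF X] borel_measurable_integrable[OF V] measurable_F[OF mcleish_prod_measurable[OF X]]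
  show "(\<lambda>\<omega>. \<Sum>k<t. c t k * X k \<omega>) \<in> borel_measurable M" for t by simp
  show "(\<lambda>\<omega>. \<tau> * V \<omega>) \<in> borel_measurable M" by simp
  fix H and u :: real assume [measurable]: "H \<in> sets M"
  define S where "S t \<omega> = (\<Sum>k<t. c t k * X k \<omega>)" for t \<omega>
  define Q where "Q t \<omega> = (\<Sum>k<t. (c t k)\<^sup>2 * (X k \<omega>)\<^sup>2)" for t \<omega>
  define T where "T t \<omega> = mcleish_prod u (c t) X t \<omega>" for t \<omega>
  define g where "g \<omega> = exp (- (u\<^sup>2 / 2) * max 0 (\<tau> * V \<omega>))" for \<omega>
  have [measurable]: "S t \<in> borel_measurable M" "Q t \<in> borel_measurable M" "T t \<in> borel_measurable M"
    "g \<in> borel_measurable M" for t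
    unfolding S_def Q_def T_def g_def by measurable
  obtain C where C: "\<And>t. (\<Sum>k<t. (c t k)\<^sup>2) \<le> C"
    using convergent_imp_Bseq[OF convergentI[OF \<tau>]] unfolding Bseq_def by (auto simp: abs_le_iff)
  define K where "K = exp (u\<^sup>2 * L\<^sup>2 * C / 2)"
  have TK: "cmod (T t \<omega>) \<le> K" if "\<omega> \<in> space M" for t \<omega>
    unfolding T_def K_def using mult_left_mono[OF C[of t], of "u\<^sup>2 * L\<^sup>2"]
    by (intro order_trans[OF cmod_mcleish_prod_le[OF X that]]) simp
  have e0: "0 \<le> e t" for t using c[of t 0] by linarith
  have g1: "0 \<le> g \<omega>" "g \<omega> \<le> 1" for \<omega> by (auto simp: g_def)
  have iQ: "integrable M (Q t)" for t
    unfolding Q_def using power_mono[OF bounded_mdsD(3)[OF X], where n=2]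
    by (intro Bochner_Integration.integrable_sum integrable_mult_right integrable_bounded[where B="L\<^sup>2"]) auto
  define R where "R t = 2 * \<bar>u\<bar>^3 * L^3 * e t * C + K * (u\<^sup>2 / 2) * (\<integral>\<omega>. \<bar>Q t \<omega> - \<tau> * V \<omega>\<bar> \<partial>M)" for t
  have close: "cmod (iexp (u * S t \<omega>) - T t \<omega> * of_real (g \<omega>))
      \<le> 2 * \<bar>u\<bar>^3 * L^3 * e t * C + K * (u\<^sup>2 / 2) * \<bar>Q t \<omega> - \<tau> * V \<omega>\<bar>" if w: "\<omega> \<in> space M" for t \<omega>
  proof -
    define q where "q = exp (- (u\<^sup>2 / 2) * Q t \<omega>)"
    have "0 \<le> Q t \<omega>" unfolding Q_def by (intro sum_nonneg) simp
    \<comment> \<open>Since \<open>Q t\<close> is nonnegative, truncating \<open>\<tau> * V\<close> at 0 can only bring it closer to \<open>Q t\<close>.\<close>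
    have "\<bar>q - g \<omega>\<bar> \<le> \<bar>u\<^sup>2 / 2 * Q t \<omega> - u\<^sup>2 / 2 * max 0 (\<tau> * V \<omega>)\<bar>"
      unfolding q_def g_def mult_minus_left using \<open>0 \<le> Q t \<omega>\<close> by (intro abs_exp_diff_le) auto
    also have "\<dots> = u\<^sup>2 / 2 * \<bar>Q t \<omega> - max 0 (\<tau> * V \<omega>)\<bar>"
      unfolding right_diff_distrib[symmetric] abs_mult by simp
    also have "\<dots> \<le> u\<^sup>2 / 2 * \<bar>Q t \<omega> - \<tau> * V \<omega>\<bar>"
      using \<open>0 \<le> Q t \<omega>\<close> by (intro mult_left_mono) auto
    finally have "cmod (T t \<omega> * of_real (q - g \<omega>)) \<le> K * (u\<^sup>2 / 2 * \<bar>Q t \<omega> - \<tau> * V \<omega>\<bar>)"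
      unfolding norm_mult using TK[OF w] by (intro mult_mono) (auto simp: K_def simp flip: of_real_diff)
    moreover have "cmod (iexp (u * S t \<omega>) - T t \<omega> * of_real q) \<le> 2 * \<bar>u\<bar>^3 * L^3 * e t * C"
      unfolding S_def T_def q_def Q_def
      using bounded_mdsD(4)[OF X] e0[of t] C[of t]
      by (intro order_trans[OF iexp_sum_approx[OF X w c]] mult_left_mono) auto
    ultimately show ?thesis
      using norm_triangle_ineq[of "iexp (u * S t \<omega>) - T t \<omega> * of_real q" "T t \<omega> * of_real (q - g \<omega>)"]
      by (simp add: algebra_simps)
  qed
  define J where "J t = (\<integral>\<omega>. indicator H \<omega> *\<^sub>R iexp (u * S t \<omega>) \<partial>M)" for t
  define J' where "J' t = (\<integral>\<omega>. T t \<omega> * of_real (indicator H \<omega> * g \<omega>) \<partial>M)" for t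
  have "cmod (J t - J' t) \<le> R t" for t
  proof -
    have i1: "integrable M (\<lambda>\<omega>. indicator H \<omega> *\<^sub>R iexp (u * S t \<omega>))"
      by (intro integrable_bounded[where B=1]) (auto split: split_indicator)
    have i2: "integrable M (\<lambda>\<omega>. T t \<omega> * of_real (indicator H \<omega> * g \<omega>))"
    proof (rule integrable_bounded[where B="K * 1"])
      fix \<omega> assume w: "\<omega> \<in> space M"
      show "norm (T t \<omega> * of_real (indicator H \<omega> * g \<omega>)) \<le> K * 1"
        unfolding norm_mult using TK[OF w] g1[of \<omega>] by (intro mult_mono) (auto simp: K_def split: split_indicator)
    qed simp
    have diff: "J t - J' t = (\<integral>\<omega>. indicator H \<omega> *\<^sub>R iexp (u * S t \<omega>) - T t \<omega> * of_real (indicator H \<omega> * g \<omega>) \<partial>M)"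
      unfolding J_def J'_def by (rule Bochner_Integration.integral_diff[OF i1 i2, symmetric])
    have "cmod (J t - J' t) \<le> (\<integral>\<omega>. 2 * \<bar>u\<bar>^3 * L^3 * e t * C + K * (u\<^sup>2 / 2) * \<bar>Q t \<omega> - \<tau> * V \<omega>\<bar> \<partial>M)"
      unfolding diff
    proof (rule norm_expectation_le)
      fix \<omega> assume w: "\<omega> \<in> space M"
      show "norm (indicator H \<omega> *\<^sub>R iexp (u * S t \<omega>) - T t \<omega> * of_real (indicator H \<omega> * g \<omega>))
          \<le> 2 * \<bar>u\<bar>^3 * L^3 * e t * C + K * (u\<^sup>2 / 2) * \<bar>Q t \<omega> - \<tau> * V \<omega>\<bar>"
      proof (cases "\<omega> \<in> H")
        case True
        then show ?thesis using close[OF w, of t] by simp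
      next
        case False
        then show ?thesis using order_trans[OF norm_ge_zero close[OF w, of t]] by simp
      qed
    next
      show "integrable M (\<lambda>\<omega>. indicator H \<omega> *\<^sub>R iexp (u * S t \<omega>) - T t \<omega> * of_real (indicator H \<omega> * g \<omega>))"
        by (rule Bochner_Integration.integrable_diff[OF i1 i2])
      show "integrable M (\<lambda>\<omega>. 2 * \<bar>u\<bar>^3 * L^3 * e t * C + K * (u\<^sup>2 / 2) * \<bar>Q t \<omega> - \<tau> * V \<omega>\<bar>)"
        using iQ V by simp
    qed
    also have "\<dots> = R t" using iQ V by (simp add: R_def prob_space)
    finally show ?thesis .
  qed
  moreover have "R \<longlonglongrightarrow> 2 * \<bar>u\<bar>^3 * L^3 * 0 * C + K * (u\<^sup>2 / 2) * 0"
    unfolding R_def[abs_def] Q_def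
    by (intro tendsto_add tendsto_mult tendsto_const e quadratic_variation_tendsto[OF X v vV V c e \<tau>])
  ultimately have "(\<lambda>t. J t - J' t) \<longlonglongrightarrow> 0"
    by (intro Lim_null_comparison[OF always_eventually, of "\<lambda>t. J t - J' t" R]) simp_all
  moreover have "J' \<longlonglongrightarrow> complex_of_real (\<integral>\<omega>. indicator H \<omega> * g \<omega> \<partial>M)"
    unfolding J'_def[abs_def] T_def using g1
    by (intro expectation_mult_mcleish_prod_tendsto[OF X C c e]) (auto split: split_indicator)
  ultimately have "(\<lambda>t. (J t - J' t) + J' t) \<longlonglongrightarrow> 0 + complex_of_real (\<integral>\<omega>. indicator H \<omega> * g \<omega> \<partial>M)"
    by (rule tendsto_add)
  then show "(\<lambda>t. \<integral>\<omega>. indicator H \<omega> *\<^sub>R iexp (u * (\<Sum>k<t. c t k * X k \<omega>)) \<partial>M)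
      \<longlonglongrightarrow> complex_of_real (\<integral>\<omega>. indicator H \<omega> * exp (- (u\<^sup>2 / 2) * max 0 (\<tau> * V \<omega>)) \<partial>M)"
    by (simp add: J_def S_def g_def)
qed

end

section \<open>Conditional moments of the urn noise\<close>

locale nonempty_urns = interacting_urns +
  assumes N_pos: "0 < N" and a_pos: "0 < a" and b_pos: "0 < b"
begin

sublocale filtered_prob_space M "urn_filtration M N I"
proof
  show "subalgebra M (urn_filtration M N I k)" for k by (rule subalgebra_urn_filtration)
  have *: "{I k i -` B \<inter> space M | k i B. k \<in> {1..t} \<and> i \<in> {1..N} \<and> B \<in> sets borel} \<subseteq> Pow (space M)" for t
    by auto
  show "sets (urn_filtration M N I k) \<subseteq> sets (urn_filtration M N I l)" if "k \<le> l" for k l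
    unfolding urn_filtration_def using that
    by (subst (1 2) sets_measure_of[OF *]) (intro sigma_sets_mono', fastforce)
qed

abbreviation Fil :: "nat \<Rightarrow> 'a measure" where "Fil \<equiv> urn_filtration M N I"
abbreviation m :: real where "m \<equiv> real (a + b)"
abbreviation share :: "nat \<Rightarrow> nat \<Rightarrow> 'a \<Rightarrow> real" where "share \<equiv> urn_prop a b I"
abbreviation mean :: "nat \<Rightarrow> 'a \<Rightarrow> real" where "mean \<equiv> urn_mean N a b I"

definition draw_prob :: "nat \<Rightarrow> nat \<Rightarrow> 'a \<Rightarrow> real" where
  "draw_prob t i \<omega> = \<alpha> * mean t \<omega> + (1 - \<alpha>) * share t i \<omega>"

text \<open>Every linear functional of the urns that matters has an innovation of this form: the coefficients
  \<open>c i = \<delta> i j - 1 / N\<close> give the deviation of urn \<open>j\<close>, and \<open>c i = 1 / N\<close> gives the mean.\<close>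

definition noise :: "(nat \<Rightarrow> real) \<Rightarrow> nat \<Rightarrow> 'a \<Rightarrow> real" where
  "noise c t \<omega> = (\<Sum>i=1..N. c i * (I (Suc t) i \<omega> - draw_prob t i \<omega>))"

definition noise_var :: "(nat \<Rightarrow> real) \<Rightarrow> nat \<Rightarrow> 'a \<Rightarrow> real" where
  "noise_var c t \<omega> = (\<Sum>i=1..N. (c i)\<^sup>2 * (draw_prob t i \<omega> * (1 - draw_prob t i \<omega>)))"

lemma m_pos: "0 < m" using a_pos by simp

lemma I_measurable_Fil:
  assumes "1 \<le> k" "k \<le> t" "i \<in> {1..N}"
  shows "I k i \<in> borel_measurable (Fil t)"
proof (rule measurableI)
  fix B :: "real set" assume "B \<in> sets borel"
  then have "I k i -` B \<inter> space M \<in> {I k i -` B \<inter> space M | k i B. k \<in> {1..t} \<and> i \<in> {1..N} \<and> B \<in> sets borel}"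
    using assms by auto
  then show "I k i -` B \<inter> space (Fil t) \<in> sets (Fil t)"
    unfolding space_F by (auto simp: urn_filtration_def intro!: sigma_sets.Basic)
qed simp

lemma share_measurable: "i \<in> {1..N} \<Longrightarrow> share t i \<in> borel_measurable (Fil t)"
  unfolding urn_prop_def[abs_def]
  by (intro borel_measurable_divide borel_measurable_add borel_measurable_sum borel_measurable_const)
    (auto intro!: I_measurable_Fil)

lemma mean_measurable: "mean t \<in> borel_measurable (Fil t)"
  unfolding urn_mean_def[abs_def]
  by (intro borel_measurable_times borel_measurable_sum borel_measurable_const share_measurable)

lemma draw_prob_measurable: "i \<in> {1..N} \<Longrightarrow> draw_prob t i \<in> borel_measurable (Fil t)"
  unfolding draw_prob_def[abs_def]
  by (intro borel_measurable_times borel_measurable_add borel_measurable_const share_measurable mean_measurable)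

lemma I_01:
  assumes "i \<in> {1..N}" "\<omega> \<in> space M"
  shows "0 \<le> I (Suc t) i \<omega>" "I (Suc t) i \<omega> \<le> 1" "(I (Suc t) i \<omega>)\<^sup>2 = I (Suc t) i \<omega>"
  using I_indicator[of "Suc t" i \<omega>] assms by auto

lemma share_01:
  assumes "i \<in> {1..N}" "\<omega> \<in> space M"
  shows "0 \<le> share t i \<omega>" "share t i \<omega> \<le> 1"
proof -
  have *: "0 \<le> I k i \<omega> \<and> I k i \<omega> \<le> 1" if "k \<in> {1..t}" for k
    using I_indicator[of k i \<omega>] assms that by auto
  have "0 \<le> (\<Sum>k=1..t. I k i \<omega>)" using * by (intro sum_nonneg) auto
  moreover have "(\<Sum>k=1..t. I k i \<omega>) \<le> (\<Sum>k=1..t. 1)" using * by (intro sum_mono) auto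
  ultimately show "0 \<le> share t i \<omega>" "share t i \<omega> \<le> 1"
    using a_pos by (auto simp: urn_prop_def)
qed

lemma mean_01:
  assumes "\<omega> \<in> space M"
  shows "0 \<le> mean t \<omega>" "mean t \<omega> \<le> 1"
proof -
  have "0 \<le> (\<Sum>i=1..N. share t i \<omega>)" using share_01 assms by (intro sum_nonneg) auto
  moreover have "(\<Sum>i=1..N. share t i \<omega>) \<le> (\<Sum>i=1..N. 1)" using share_01 assms by (intro sum_mono) auto
  ultimately show "0 \<le> mean t \<omega>" "mean t \<omega> \<le> 1"
    using N_pos by (auto simp: urn_mean_def)
qed

lemma draw_prob_01:
  assumes "i \<in> {1..N}" "\<omega> \<in> space M"
  shows "0 \<le> draw_prob t i \<omega>" "draw_prob t i \<omega> \<le> 1"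
  using share_01[OF assms, of t] mean_01[OF assms(2), of t] alpha convex_bound_le[of "mean t \<omega>" 1 "share t i \<omega>" \<alpha> "1 - \<alpha>"]
  by (auto simp: draw_prob_def)

lemma sum_draw_prob: "(\<Sum>i=1..N. draw_prob t i \<omega>) = real N * mean t \<omega>"
proof -
  have "(\<Sum>i=1..N. share t i \<omega>) = real N * mean t \<omega>" using N_pos by (simp add: urn_mean_def)
  then show ?thesis
    by (simp add: draw_prob_def sum.distrib flip: sum_distrib_left) (simp add: algebra_simps)
qed

lemma noise_measurable: "noise c t \<in> borel_measurable (Fil (Suc t))"
  unfolding noise_def[abs_def]
  by (intro borel_measurable_sum borel_measurable_times borel_measurable_diff borel_measurable_const
      I_measurable_Fil measurable_F_mono[OF draw_prob_measurable]) auto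

lemma noise_var_measurable: "noise_var c t \<in> borel_measurable (Fil t)"
  unfolding noise_var_def[abs_def]
  by (intro borel_measurable_sum borel_measurable_times borel_measurable_diff borel_measurable_const
      draw_prob_measurable)

lemma abs_noise_le:
  assumes "\<omega> \<in> space M" shows "\<bar>noise c t \<omega>\<bar> \<le> (\<Sum>i=1..N. \<bar>c i\<bar>)"
  unfolding noise_def
proof (rule order_trans[OF sum_abs], rule sum_mono)
  fix i assume i: "i \<in> {1..N}"
  have "\<bar>I (Suc t) i \<omega> - draw_prob t i \<omega>\<bar> \<le> 1"
    using I_01[OF i assms, of t] draw_prob_01[OF i assms, of t] by auto
  then show "\<bar>c i * (I (Suc t) i \<omega> - draw_prob t i \<omega>)\<bar> \<le> \<bar>c i\<bar>"
    by (simp add: abs_mult mult_left_le)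
qed

lemma noise_var_bounds:
  assumes "\<omega> \<in> space M" shows "0 \<le> noise_var c t \<omega>" "noise_var c t \<omega> \<le> (\<Sum>i=1..N. (c i)\<^sup>2)"
proof -
  have *: "0 \<le> draw_prob t i \<omega> * (1 - draw_prob t i \<omega>)" "draw_prob t i \<omega> * (1 - draw_prob t i \<omega>) \<le> 1"
    if "i \<in> {1..N}" for i
    using draw_prob_01[OF that assms, of t] by (auto intro: mult_le_one)
  then show "0 \<le> noise_var c t \<omega>" unfolding noise_var_def by (intro sum_nonneg) auto
  show "noise_var c t \<omega> \<le> (\<Sum>i=1..N. (c i)\<^sup>2)"
    unfolding noise_var_def using * by (intro sum_mono mult_left_le) auto
qed

lemma expectation_mult_I:
  assumes i: "i \<in> {1..N}" and G: "G \<in> borel_measurable (Fil t)"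
    and bd: "\<And>\<omega>. \<omega> \<in> space M \<Longrightarrow> \<bar>G \<omega>\<bar> \<le> (B::real)"
  shows "(\<integral>\<omega>. G \<omega> * I (Suc t) i \<omega> \<partial>M) = (\<integral>\<omega>. G \<omega> * draw_prob t i \<omega> \<partial>M)"
proof -
  let ?A = "{x \<in> space M. I (Suc t) i x = 1}"
  have [measurable]: "I (Suc t) i \<in> borel_measurable M" using i by (intro I_measurable) auto
  note [measurable] = measurable_F[OF G] measurable_F[OF draw_prob_measurable[OF i]]
  have "(\<integral>\<omega>. G \<omega> * I (Suc t) i \<omega> \<partial>M) = (\<integral>\<omega>. G \<omega> * indicator ?A \<omega> \<partial>M)"
    using I_indicator[of "Suc t" i] i by (intro Bochner_Integration.integral_cong) (fastforce simp: indicator_def)+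
  also have "\<dots> = (\<integral>\<omega>. G \<omega> * real_cond_exp M (Fil t) (indicator ?A) \<omega> \<partial>M)"
    using bd by (intro cond.real_cond_exp_intg(2)[symmetric] G integrable_bounded[where B=B])
      (auto simp: indicator_def intro: order_trans[OF abs_ge_zero])
  also have "\<dots> = (\<integral>\<omega>. G \<omega> * draw_prob t i \<omega> \<partial>M)"
    using cond_law[OF i, of t] unfolding prob_given_def draw_prob_def[symmetric]
    by (intro integral_cong_AE) auto
  finally show ?thesis .
qed

lemma expectation_mult_I_I:
  assumes i: "i \<in> {1..N}" and l: "l \<in> {1..N}" and "i \<noteq> l" and G: "G \<in> borel_measurable (Fil t)"
    and bd: "\<And>\<omega>. \<omega> \<in> space M \<Longrightarrow> \<bar>G \<omega>\<bar> \<le> (B::real)"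
  shows "(\<integral>\<omega>. G \<omega> * (I (Suc t) i \<omega> * I (Suc t) l \<omega>) \<partial>M) = (\<integral>\<omega>. G \<omega> * (draw_prob t i \<omega> * draw_prob t l \<omega>) \<partial>M)"
proof -
  let ?A = "{x \<in> space M. \<forall>j\<in>{i, l}. I (Suc t) j x \<in> {1}}"
  have [measurable]: "I (Suc t) i \<in> borel_measurable M" "I (Suc t) l \<in> borel_measurable M"
    using i l by (auto intro: I_measurable)
  note [measurable] = measurable_F[OF G] measurable_F[OF draw_prob_measurable[OF i]] measurable_F[OF draw_prob_measurable[OF l]]
  have A[measurable]: "?A \<in> sets M" by simp
  have "AE \<omega> in M. prob_given M (Fil t) ?A \<omega>
      = (\<Prod>j\<in>{i, l}. prob_given M (Fil t) {x \<in> space M. I (Suc t) j x \<in> {1}} \<omega>)"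
    using cond_indep[of t] i l unfolding cond_indep_vars_def by (elim conjE allE[of _ "{i, l}"] allE[of _ "\<lambda>_. {1}"]) auto
  with cond_law[OF i, of t] cond_law[OF l, of t]
  have law: "AE \<omega> in M. real_cond_exp M (Fil t) (indicator ?A) \<omega> = draw_prob t i \<omega> * draw_prob t l \<omega>"
    unfolding draw_prob_def[symmetric] prob_given_def by eventually_elim (simp add: \<open>i \<noteq> l\<close>)
  have "(\<integral>\<omega>. G \<omega> * (I (Suc t) i \<omega> * I (Suc t) l \<omega>) \<partial>M) = (\<integral>\<omega>. G \<omega> * indicator ?A \<omega> \<partial>M)"
    using I_indicator[of "Suc t" i] I_indicator[of "Suc t" l] i l
    by (intro Bochner_Integration.integral_cong) (fastforce simp: indicator_def)+
  also have "\<dots> = (\<integral>\<omega>. G \<omega> * real_cond_exp M (Fil t) (indicator ?A) \<omega> \<partial>M)"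
    using bd by (intro cond.real_cond_exp_intg(2)[symmetric] G integrable_bounded[where B=B])
      (auto simp: indicator_def intro: order_trans[OF abs_ge_zero])
  also have "\<dots> = (\<integral>\<omega>. G \<omega> * (draw_prob t i \<omega> * draw_prob t l \<omega>) \<partial>M)"
    using law by (intro integral_cong_AE) auto
  finally show ?thesis .
qed

text \<open>Testing against \<open>G\<close> expresses conditional moments without reference to versions: the two draws
  have conditional covariance zero when they belong to different urns, and the Bernoulli variance
  when they coincide.\<close>

lemma noise_product:
  assumes i: "i \<in> {1..N}" and l: "l \<in> {1..N}" and G: "G \<in> borel_measurable (Fil t)"
    and bd: "\<And>\<omega>. \<omega> \<in> space M \<Longrightarrow> \<bar>G \<omega>\<bar> \<le> (B::real)"
  shows "(\<integral>\<omega>. G \<omega> * ((I (Suc t) i \<omega> - draw_prob t i \<omega>) * (I (Suc t) l \<omega> - draw_prob t l \<omega>)) \<partial>M)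
    = (if i = l then \<integral>\<omega>. G \<omega> * (draw_prob t i \<omega> * (1 - draw_prob t i \<omega>)) \<partial>M else 0)"
proof -
  have B: "0 \<le> B" using bd not_empty order_trans[OF abs_ge_zero] by blast
  have [measurable]: "I (Suc t) i \<in> borel_measurable M" "I (Suc t) l \<in> borel_measurable M"
    using i l by (auto intro: I_measurable)
  have p01: "\<bar>draw_prob t k \<omega>\<bar> \<le> 1" if "k \<in> {1..N}" "\<omega> \<in> space M" for k \<omega>
    using draw_prob_01[OF that, of t] by simp
  have I01: "\<bar>I (Suc t) k \<omega>\<bar> \<le> 1" if "k \<in> {1..N}" "\<omega> \<in> space M" for k \<omega>
    using I_01[OF that, of t] by simp
  have Gp: "(\<lambda>\<omega>. G \<omega> * draw_prob t k \<omega>) \<in> borel_measurable (Fil t)" if "k \<in> {1..N}" for k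
    by (intro borel_measurable_times G draw_prob_measurable that)
  have Gpb: "\<bar>G \<omega> * draw_prob t k \<omega>\<bar> \<le> B" if "k \<in> {1..N}" "\<omega> \<in> space M" for k \<omega>
    using mult_mono[OF bd[OF that(2)] p01[OF that] B] by (simp add: abs_mult)
  note [measurable] = measurable_F[OF G] measurable_F[OF draw_prob_measurable[OF i]] measurable_F[OF draw_prob_measurable[OF l]]
  have GI: "\<bar>G \<omega> * I (Suc t) k \<omega>\<bar> \<le> B" if "k \<in> {1..N}" "\<omega> \<in> space M" for k \<omega>
    using mult_mono[OF bd[OF that(2)] I01[OF that] B] by (simp add: abs_mult)
  have ints: "integrable M (\<lambda>\<omega>. (G \<omega> * I (Suc t) i \<omega>) * I (Suc t) l \<omega>)"
    "integrable M (\<lambda>\<omega>. (G \<omega> * draw_prob t i \<omega>) * I (Suc t) l \<omega>)"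
    "integrable M (\<lambda>\<omega>. (G \<omega> * draw_prob t l \<omega>) * I (Suc t) i \<omega>)"
    "integrable M (\<lambda>\<omega>. (G \<omega> * draw_prob t i \<omega>) * draw_prob t l \<omega>)"
    "integrable M (\<lambda>\<omega>. G \<omega> * draw_prob t i \<omega>)"
    using GI[OF i] Gpb[OF i] Gpb[OF l] I01[OF i] I01[OF l] p01[OF i] p01[OF l] bd
    by (auto intro!: integrable_mult_bounded[where B=B and C=1])
  have "(\<integral>\<omega>. G \<omega> * ((I (Suc t) i \<omega> - draw_prob t i \<omega>) * (I (Suc t) l \<omega> - draw_prob t l \<omega>)) \<partial>M)
    = (\<integral>\<omega>. (G \<omega> * I (Suc t) i \<omega>) * I (Suc t) l \<omega> - (G \<omega> * draw_prob t i \<omega>) * I (Suc t) l \<omega>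
        - (G \<omega> * draw_prob t l \<omega>) * I (Suc t) i \<omega> + (G \<omega> * draw_prob t i \<omega>) * draw_prob t l \<omega> \<partial>M)"
    by (intro Bochner_Integration.integral_cong) (auto simp: algebra_simps)
  also have "\<dots> = (\<integral>\<omega>. (G \<omega> * I (Suc t) i \<omega>) * I (Suc t) l \<omega> \<partial>M) - (\<integral>\<omega>. (G \<omega> * draw_prob t i \<omega>) * I (Suc t) l \<omega> \<partial>M)
        - (\<integral>\<omega>. (G \<omega> * draw_prob t l \<omega>) * I (Suc t) i \<omega> \<partial>M) + (\<integral>\<omega>. (G \<omega> * draw_prob t i \<omega>) * draw_prob t l \<omega> \<partial>M)"
    using ints by simp
  also have "(\<integral>\<omega>. (G \<omega> * draw_prob t i \<omega>) * I (Suc t) l \<omega> \<partial>M) = (\<integral>\<omega>. (G \<omega> * draw_prob t i \<omega>) * draw_prob t l \<omega> \<partial>M)"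
    by (rule expectation_mult_I[OF l Gp[OF i] Gpb[OF i]])
  also have "(\<integral>\<omega>. (G \<omega> * draw_prob t l \<omega>) * I (Suc t) i \<omega> \<partial>M) = (\<integral>\<omega>. (G \<omega> * draw_prob t l \<omega>) * draw_prob t i \<omega> \<partial>M)"
    by (rule expectation_mult_I[OF i Gp[OF l] Gpb[OF l]])
  also have "\<dots> = (\<integral>\<omega>. (G \<omega> * draw_prob t i \<omega>) * draw_prob t l \<omega> \<partial>M)" by (simp add: mult_ac)
  finally have eq: "(\<integral>\<omega>. G \<omega> * ((I (Suc t) i \<omega> - draw_prob t i \<omega>) * (I (Suc t) l \<omega> - draw_prob t l \<omega>)) \<partial>M)
    = (\<integral>\<omega>. (G \<omega> * I (Suc t) i \<omega>) * I (Suc t) l \<omega> \<partial>M) - (\<integral>\<omega>. (G \<omega> * draw_prob t i \<omega>) * draw_prob t l \<omega> \<partial>M)"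
    by simp
  show ?thesis
  proof (cases "i = l")
    case False
    then show ?thesis
      using expectation_mult_I_I[OF i l False G bd] unfolding eq by (simp add: mult.assoc)
  next
    case True
    have "(\<integral>\<omega>. (G \<omega> * I (Suc t) i \<omega>) * I (Suc t) i \<omega> \<partial>M) = (\<integral>\<omega>. G \<omega> * I (Suc t) i \<omega> \<partial>M)"
      using I_01(3)[OF i] by (intro Bochner_Integration.integral_cong) (auto simp: power2_eq_square mult.assoc)
    also have "\<dots> = (\<integral>\<omega>. G \<omega> * draw_prob t i \<omega> \<partial>M)" by (rule expectation_mult_I[OF i G bd])
    finally show ?thesis
      using True ints(4,5) unfolding eq by (simp add: algebra_simps)
  qed
qed

text \<open>Conditionally on the past the draws are uncorrelated, so only the diagonal terms of the expanded
  square survive. Hence \<open>noise_var\<close> is the conditional variance of \<open>noise\<close>.\<close>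

lemma expectation_mult_noise:
  assumes G: "G \<in> borel_measurable (Fil t)" and bd: "\<And>\<omega>. \<omega> \<in> space M \<Longrightarrow> \<bar>G \<omega>\<bar> \<le> (B::real)"
  shows "(\<integral>\<omega>. G \<omega> * noise c t \<omega> \<partial>M) = 0"
    and "(\<integral>\<omega>. G \<omega> * (noise c t \<omega>)\<^sup>2 \<partial>M) = (\<integral>\<omega>. G \<omega> * noise_var c t \<omega> \<partial>M)"
proof -
  define y where "y i \<omega> = I (Suc t) i \<omega> - draw_prob t i \<omega>" for i \<omega>
  define q where "q i \<omega> = draw_prob t i \<omega> * (1 - draw_prob t i \<omega>)" for i \<omega>
  have Im: "I (Suc t) i \<in> borel_measurable M" if "i \<in> {1..N}" for i using that by (auto intro: I_measurable)
  have pm: "draw_prob t i \<in> borel_measurable M" if "i \<in> {1..N}" for i by (rule measurable_F[OF draw_prob_measurable[OF that]])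
  have Gm[measurable]: "G \<in> borel_measurable M" by (rule measurable_F[OF G])
  have ym: "y i \<in> borel_measurable M" and qm: "q i \<in> borel_measurable M" if "i \<in> {1..N}" for i
    unfolding y_def[abs_def] q_def[abs_def] using Im[OF that] pm[OF that] by measurable
  have y1: "\<bar>y i \<omega>\<bar> \<le> 1" if "i \<in> {1..N}" "\<omega> \<in> space M" for i \<omega>
    unfolding y_def using I_01[OF that, of t] draw_prob_01[OF that, of t] by auto
  have q1: "\<bar>q i \<omega>\<bar> \<le> 1" if "i \<in> {1..N}" "\<omega> \<in> space M" for i \<omega>
    unfolding q_def using draw_prob_01[OF that, of t] by (auto simp: abs_mult intro: mult_le_one)
  have yy1: "\<bar>y i \<omega> * y l \<omega>\<bar> \<le> 1" if "i \<in> {1..N}" "l \<in> {1..N}" "\<omega> \<in> space M" for i l \<omega>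
    unfolding abs_mult using y1 that by (intro mult_le_one) auto
  have iI: "integrable M (\<lambda>\<omega>. G \<omega> * I (Suc t) i \<omega>)" and ip: "integrable M (\<lambda>\<omega>. G \<omega> * draw_prob t i \<omega>)"
    if "i \<in> {1..N}" for i
    using I_01[OF that, of _ t] draw_prob_01[OF that, of _ t] bd
    by (auto intro!: integrable_mult_bounded[where B=B and C=1] Im pm that)
  have "(\<integral>\<omega>. G \<omega> * noise c t \<omega> \<partial>M) = (\<integral>\<omega>. (\<Sum>i=1..N. c i * (G \<omega> * I (Suc t) i \<omega> - G \<omega> * draw_prob t i \<omega>)) \<partial>M)"
    by (simp add: noise_def sum_distrib_left algebra_simps)
  also have "\<dots> = (\<Sum>i=1..N. c i * ((\<integral>\<omega>. G \<omega> * I (Suc t) i \<omega> \<partial>M) - (\<integral>\<omega>. G \<omega> * draw_prob t i \<omega> \<partial>M)))"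
    using iI ip by (subst Bochner_Integration.integral_sum) auto
  also have "\<dots> = 0" using expectation_mult_I[OF _ G bd] by (intro sum.neutral) auto
  finally show "(\<integral>\<omega>. G \<omega> * noise c t \<omega> \<partial>M) = 0" .
  have iyy: "integrable M (\<lambda>\<omega>. G \<omega> * (y i \<omega> * y l \<omega>))" if "i \<in> {1..N}" "l \<in> {1..N}" for i l
    using yy1[OF that] bd ym that by (intro integrable_mult_bounded[where B=B and C=1]) auto
  have iq: "integrable M (\<lambda>\<omega>. G \<omega> * q i \<omega>)" if "i \<in> {1..N}" for i
    using q1[OF that] bd qm that by (intro integrable_mult_bounded[where B=B and C=1]) auto
  have "(\<integral>\<omega>. G \<omega> * (noise c t \<omega>)\<^sup>2 \<partial>M) = (\<integral>\<omega>. (\<Sum>i=1..N. \<Sum>l=1..N. c i * c l * (G \<omega> * (y i \<omega> * y l \<omega>))) \<partial>M)"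
    by (simp add: noise_def y_def power2_eq_square sum_product sum_distrib_left mult_ac)
  also have "\<dots> = (\<Sum>i=1..N. \<Sum>l=1..N. c i * c l * (\<integral>\<omega>. G \<omega> * (y i \<omega> * y l \<omega>) \<partial>M))"
  proof -
    have int: "integrable M (\<lambda>\<omega>. c i * c l * (G \<omega> * (y i \<omega> * y l \<omega>)))"
      if "i \<in> {1..N}" "l \<in> {1..N}" for i l
      by (intro integrable_mult_right iyy that)
    then show ?thesis
      by (simp only: Bochner_Integration.integral_sum Bochner_Integration.integrable_sum integral_mult_right_zero cong: sum.cong)
  qed
  also have "\<dots> = (\<Sum>i=1..N. \<Sum>l=1..N. if i = l then c i * c i * (\<integral>\<omega>. G \<omega> * q i \<omega> \<partial>M) else 0)"
    using noise_product[OF _ _ G bd] by (intro sum.cong refl) (auto simp: y_def q_def)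
  also have "\<dots> = (\<Sum>i=1..N. (c i)\<^sup>2 * (\<integral>\<omega>. G \<omega> * q i \<omega> \<partial>M))"
    by (simp add: power2_eq_square)
  also have "\<dots> = (\<integral>\<omega>. (\<Sum>i=1..N. (c i)\<^sup>2 * (G \<omega> * q i \<omega>)) \<partial>M)"
    using iq by (simp add: Bochner_Integration.integral_sum)
  also have "\<dots> = (\<integral>\<omega>. G \<omega> * noise_var c t \<omega> \<partial>M)"
    by (simp add: noise_var_def q_def sum_distrib_left mult_ac)
  finally show "(\<integral>\<omega>. G \<omega> * (noise c t \<omega>)\<^sup>2 \<partial>M) = (\<integral>\<omega>. G \<omega> * noise_var c t \<omega> \<partial>M)" .
qed

lemma bounded_mds_noise: "bounded_mds (\<Sum>i=1..N. \<bar>c i\<bar>) (noise c)"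
  by (intro bounded_mdsI noise_measurable abs_noise_le expectation_mult_noise(1)[where B=1]) auto

lemma bounded_mds_noise_square:
  "bounded_mds ((\<Sum>i=1..N. \<bar>c i\<bar>)\<^sup>2 + (\<Sum>i=1..N. (c i)\<^sup>2)) (\<lambda>t \<omega>. (noise c t \<omega>)\<^sup>2 - noise_var c t \<omega>)"
proof (rule bounded_mdsI)
  note [measurable] = noise_measurable
  show "(\<lambda>\<omega>. (noise c t \<omega>)\<^sup>2 - noise_var c t \<omega>) \<in> borel_measurable (Fil (Suc t))" for t
    using measurable_F_mono[OF noise_var_measurable, of t "Suc t"] by simp
  have sq: "(noise c t \<omega>)\<^sup>2 \<le> (\<Sum>i=1..N. \<bar>c i\<bar>)\<^sup>2" if "\<omega> \<in> space M" for t \<omega>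
    using power_mono[OF abs_noise_le[OF that], where n=2] by simp
  show "\<bar>(noise c t \<omega>)\<^sup>2 - noise_var c t \<omega>\<bar> \<le> (\<Sum>i=1..N. \<bar>c i\<bar>)\<^sup>2 + (\<Sum>i=1..N. (c i)\<^sup>2)"
    if "\<omega> \<in> space M" for t \<omega>
    using sq[OF that, of t] noise_var_bounds[OF that, of c t] zero_le_power2[of "noise c t \<omega>"] by linarith
  fix t A assume A: "A \<in> sets (Fil t)"
  have G: "indicator A \<in> borel_measurable (Fil t)" using A by simp
  note [measurable] = measurable_F[OF G] measurable_F[OF noise_measurable] measurable_F[OF noise_var_measurable]
  have "integrable M (\<lambda>\<omega>. indicator A \<omega> * (noise c t \<omega>)\<^sup>2)"
    using sq by (intro integrable_mult_bounded[where B=1]) auto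
  moreover have "integrable M (\<lambda>\<omega>. indicator A \<omega> * noise_var c t \<omega>)"
    using noise_var_bounds[of _ c t] by (intro integrable_mult_bounded[where B=1]) auto
  ultimately show "(\<integral>\<omega>. indicator A \<omega> * ((noise c t \<omega>)\<^sup>2 - noise_var c t \<omega>) \<partial>M) = 0"
    using expectation_mult_noise(2)[OF G, of 1 c] by (simp add: right_diff_distrib)
qed

section \<open>The deviation of one urn from the mean\<close>

definition contrast :: "nat \<Rightarrow> nat \<Rightarrow> real" where
  "contrast j i = (if i = j then 1 else 0) - 1 / real N"

lemma sum_contrast_mult:
  assumes "j \<in> {1..N}"
  shows "(\<Sum>i=1..N. contrast j i * f i) = f j - (\<Sum>i=1..N. f i) / real N"
proof -
  have "(\<Sum>i=1..N. contrast j i * f i) = (\<Sum>i=1..N. (if i = j then f i else 0) - f i / real N)"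
    by (intro sum.cong refl) (simp add: contrast_def left_diff_distrib)
  then show ?thesis using assms by (simp add: sum_subtractf sum_divide_distrib)
qed

lemma sum_contrast_square:
  assumes "j \<in> {1..N}"
  shows "(\<Sum>i=1..N. (contrast j i)\<^sup>2) = 1 - 1 / real N"
proof -
  have "(\<Sum>i=1..N. contrast j i) = 0" using sum_contrast_mult[OF assms, of "\<lambda>_. 1"] N_pos by simp
  then show ?thesis
    using sum_contrast_mult[OF assms, of "contrast j"] by (simp add: power2_eq_square) (simp add: contrast_def)
qed

lemma mean_Suc:
  "mean (Suc t) \<omega> = mean t \<omega> + ((\<Sum>i=1..N. I (Suc t) i \<omega>) / real N - mean t \<omega>) / (m + real (Suc t))"
proof -
  have "share (Suc t) i \<omega> = share t i \<omega> + (I (Suc t) i \<omega> - share t i \<omega>) / (m + real (Suc t))" for i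
    using urn_prop_Suc[of a b I t i \<omega>] a_pos by (simp add: algebra_simps)
  then have "(\<Sum>i=1..N. share (Suc t) i \<omega>) = (\<Sum>i=1..N. share t i \<omega>)
      + ((\<Sum>i=1..N. I (Suc t) i \<omega>) - (\<Sum>i=1..N. share t i \<omega>)) / (m + real (Suc t))"
    by (simp add: sum.distrib sum_subtractf flip: sum_divide_distrib)
  then show ?thesis
    unfolding urn_mean_def by (simp add: add_divide_distrib diff_divide_distrib mult.commute)
qed

text \<open>Given the past, the draw from urn \<open>j\<close> exceeds the average draw by \<open>1 - \<alpha>\<close> times the present
  deviation in the mean. An excess equal to the full deviation would leave it unchanged, so that it
  contracts by the factor \<open>1 - \<alpha> / (m + t + 1)\<close>, up to noise.\<close>

lemma deviation_Suc:
  assumes j: "j \<in> {1..N}"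
  shows "share (Suc t) j \<omega> - mean (Suc t) \<omega>
    = (1 - \<alpha> / (m + real (Suc t))) * (share t j \<omega> - mean t \<omega>) + noise (contrast j) t \<omega> / (m + real (Suc t))"
proof -
  define n where "n = m + real (Suc t)"
  define S where "S = (\<Sum>i=1..N. I (Suc t) i \<omega>) / real N"
  have n: "0 < n" using m_pos by (simp add: n_def)
  have "noise (contrast j) t \<omega> = (I (Suc t) j \<omega> - draw_prob t j \<omega>)
      - ((\<Sum>i=1..N. I (Suc t) i \<omega>) - real N * mean t \<omega>) / real N"
    unfolding noise_def sum_contrast_mult[OF j] sum_subtractf sum_draw_prob ..
  then have noise: "noise (contrast j) t \<omega> = I (Suc t) j \<omega> - S - (1 - \<alpha>) * (share t j \<omega> - mean t \<omega>)"
    using N_pos by (simp add: draw_prob_def S_def diff_divide_distrib algebra_simps)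
  have share: "share (Suc t) j \<omega> = share t j \<omega> + (I (Suc t) j \<omega> - share t j \<omega>) / n"
    using urn_prop_Suc[of a b I t j \<omega>] a_pos by (simp add: algebra_simps n_def)
  show ?thesis
    unfolding mean_Suc share noise n_def[symmetric] S_def[symmetric]
    using n by (simp add: field_simps)
qed

lemma deviation_eq:
  assumes "j \<in> {1..N}"
  shows "share t j \<omega> - mean t \<omega> = (\<Sum>k<t. weight \<alpha> m t k * noise (contrast j) k \<omega>)"
proof (rule recursion_solution[OF alpha(2) m_pos])
  show "share 0 j \<omega> - mean 0 \<omega> = 0"
    using N_pos by (simp add: urn_mean_def urn_prop_0)
qed (rule deviation_Suc[OF assms])

lemma limit_01:
  assumes "AE \<omega> in M. (\<lambda>t. mean t \<omega>) \<longlonglongrightarrow> Z \<omega>"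
  shows "AE \<omega> in M. 0 \<le> Z \<omega> \<and> Z \<omega> \<le> 1"
  using assms
proof (rule AE_mp, intro AE_I2 impI conjI)
  fix \<omega> assume w: "\<omega> \<in> space M" and l: "(\<lambda>t. mean t \<omega>) \<longlonglongrightarrow> Z \<omega>"
  show "0 \<le> Z \<omega>" using mean_01(1)[OF w] by (intro LIMSEQ_le_const[OF l]) auto
  show "Z \<omega> \<le> 1" using mean_01(2)[OF w] by (intro LIMSEQ_le_const2[OF l]) auto
qed

lemma integrable_limit:
  assumes [measurable]: "Z \<in> borel_measurable M" and "AE \<omega> in M. (\<lambda>t. mean t \<omega>) \<longlonglongrightarrow> Z \<omega>"
  shows "integrable M Z" "integrable M (\<lambda>\<omega>. (Z \<omega>)\<^sup>2)"
  using limit_01[OF assms(2)] by (auto intro!: integrable_const_bound[where B=1] simp: power_le_one)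

text \<open>Since \<open>x * (1 - x)\<close> is 1-Lipschitz on \<open>[0, 1]\<close>, it is enough that every drawing probability tends to
  \<open>Z\<close> in \<open>L\<^sup>1\<close>. Each is the mean plus a multiple of the deviation of its urn, whose
  \<open>L\<^sup>2\<close> norm, hence also its \<open>L\<^sup>1\<close> norm, is at most a constant times the root of the sum of the
  squared weights.\<close>

lemma noise_var_contrast_tendsto:
  assumes Z[measurable]: "Z \<in> borel_measurable M" and lim: "AE \<omega> in M. (\<lambda>t. mean t \<omega>) \<longlonglongrightarrow> Z \<omega>"
    and w: "(\<lambda>t. \<Sum>k<t. (weight \<alpha> m t k)\<^sup>2) \<longlonglongrightarrow> 0" and j: "j \<in> {1..N}"
  shows "(\<lambda>t. \<integral>\<omega>. \<bar>noise_var (contrast j) t \<omega> - (1 - 1 / real N) * (Z \<omega> - (Z \<omega>)\<^sup>2)\<bar> \<partial>M) \<longlonglongrightarrow> 0"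
proof -
  note [measurable] = measurable_F[OF mean_measurable] measurable_F[OF noise_var_measurable]
  note Z01 = limit_01[OF lim]
  note iZ = integrable_limit[OF Z lim]
  have imean: "integrable M (mean t)" for t
    using mean_01[of _ t] by (intro integrable_bounded[where B=1]) auto
  have mean_conv: "(\<lambda>t. \<integral>\<omega>. \<bar>mean t \<omega> - Z \<omega>\<bar> \<partial>M) \<longlonglongrightarrow> 0"
  proof -
    have "(\<lambda>t. \<integral>\<omega>. \<bar>mean t \<omega> - Z \<omega>\<bar> \<partial>M) \<longlonglongrightarrow> (\<integral>\<omega>. 0 \<partial>M)"
    proof (rule integral_dominated_convergence[where w="\<lambda>_. 1"])
      show "AE \<omega> in M. (\<lambda>t. \<bar>mean t \<omega> - Z \<omega>\<bar>) \<longlonglongrightarrow> 0"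
        using lim
      proof eventually_elim
        case (elim \<omega>)
        from tendsto_rabs[OF tendsto_diff[OF elim tendsto_const[of "Z \<omega>"]]] show ?case by simp
      qed
      show "AE \<omega> in M. norm \<bar>mean t \<omega> - Z \<omega>\<bar> \<le> 1" for t
        using Z01 AE_space
      proof eventually_elim
        case (elim \<omega>)
        then show ?case using mean_01[of \<omega> t] by auto
      qed
    qed simp_all
    then show ?thesis by simp
  qed
  define D where "D i t \<omega> = share t i \<omega> - mean t \<omega>" for i t \<omega>
  have D_int: "integrable M (D i t)" if "i \<in> {1..N}" for i t
    unfolding D_def[abs_def] using share_01[OF that, of _ t] mean_01[of _ t] measurable_F[OF share_measurable[OF that]]
    by (intro Bochner_Integration.integrable_diff imean integrable_bounded[where B=1]) auto
  have D_conv: "(\<lambda>t. \<integral>\<omega>. \<bar>D i t \<omega>\<bar> \<partial>M) \<longlonglongrightarrow> 0" if i: "i \<in> {1..N}" for i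
  proof -
    have lim: "(\<lambda>t. (\<Sum>l=1..N. \<bar>contrast i l\<bar>) * sqrt (\<Sum>k<t. (weight \<alpha> m t k)\<^sup>2)) \<longlonglongrightarrow> 0"
      using tendsto_mult[OF tendsto_const tendsto_real_sqrt[OF w], of "\<Sum>l=1..N. \<bar>contrast i l\<bar>"] by simp
    have "(\<integral>\<omega>. \<bar>D i t \<omega>\<bar> \<partial>M) \<le> (\<Sum>l=1..N. \<bar>contrast i l\<bar>) * sqrt (\<Sum>k<t. (weight \<alpha> m t k)\<^sup>2)" for t
      unfolding D_def deviation_eq[OF i] by (rule expectation_abs_weighted_sum_le[OF bounded_mds_noise])
    then show ?thesis
      by (intro tendsto_sandwich[OF always_eventually always_eventually tendsto_const lim]) auto
  qed
  define B where "B t = (\<Sum>i=1..N. (contrast j i)\<^sup>2 * ((\<integral>\<omega>. \<bar>mean t \<omega> - Z \<omega>\<bar> \<partial>M) + (\<integral>\<omega>. \<bar>D i t \<omega>\<bar> \<partial>M)))" for t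
  have "B \<longlonglongrightarrow> (\<Sum>i=1..N. (contrast j i)\<^sup>2 * (0 + 0))"
    unfolding B_def[abs_def] by (intro tendsto_sum tendsto_mult tendsto_add tendsto_const mean_conv D_conv)
  then have B0: "B \<longlonglongrightarrow> 0" by simp
  have "(\<integral>\<omega>. \<bar>noise_var (contrast j) t \<omega> - (1 - 1 / real N) * (Z \<omega> - (Z \<omega>)\<^sup>2)\<bar> \<partial>M) \<le> B t" for t
  proof -
    have "(\<integral>\<omega>. \<bar>noise_var (contrast j) t \<omega> - (1 - 1 / real N) * (Z \<omega> - (Z \<omega>)\<^sup>2)\<bar> \<partial>M)
      \<le> (\<integral>\<omega>. (\<Sum>i=1..N. (contrast j i)\<^sup>2 * (\<bar>mean t \<omega> - Z \<omega>\<bar> + \<bar>D i t \<omega>\<bar>)) \<partial>M)"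
    proof (rule integral_mono_AE)
      have "integrable M (noise_var (contrast j) t)"
        using noise_var_bounds[of _ "contrast j" t] by (intro integrable_bounded[where B="\<Sum>i=1..N. (contrast j i)\<^sup>2"]) auto
      then show "integrable M (\<lambda>\<omega>. \<bar>noise_var (contrast j) t \<omega> - (1 - 1 / real N) * (Z \<omega> - (Z \<omega>)\<^sup>2)\<bar>)"
        using iZ by (intro integrable_abs Bochner_Integration.integrable_diff integrable_mult_right)
      show "integrable M (\<lambda>\<omega>. \<Sum>i=1..N. (contrast j i)\<^sup>2 * (\<bar>mean t \<omega> - Z \<omega>\<bar> + \<bar>D i t \<omega>\<bar>))"
        using iZ imean D_int by (intro Bochner_Integration.integrable_sum integrable_mult_right Bochner_Integration.integrable_add integrable_abs Bochner_Integration.integrable_diff)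
      show "AE \<omega> in M. \<bar>noise_var (contrast j) t \<omega> - (1 - 1 / real N) * (Z \<omega> - (Z \<omega>)\<^sup>2)\<bar>
          \<le> (\<Sum>i=1..N. (contrast j i)\<^sup>2 * (\<bar>mean t \<omega> - Z \<omega>\<bar> + \<bar>D i t \<omega>\<bar>))"
        using Z01 AE_space
      proof eventually_elim
        case (elim \<omega>)
        have close: "\<bar>draw_prob t i \<omega> * (1 - draw_prob t i \<omega>) - (Z \<omega> - (Z \<omega>)\<^sup>2)\<bar> \<le> \<bar>mean t \<omega> - Z \<omega>\<bar> + \<bar>D i t \<omega>\<bar>"
          if i: "i \<in> {1..N}" for i
        proof -
          define p where "p = draw_prob t i \<omega>"
          have p: "0 \<le> p" "p \<le> 1" unfolding p_def using draw_prob_01[OF i] elim by auto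
          have "\<bar>p * (1 - p) - (Z \<omega> - (Z \<omega>)\<^sup>2)\<bar> = \<bar>p - Z \<omega>\<bar> * \<bar>1 - p - Z \<omega>\<bar>"
            unfolding abs_mult[symmetric] by (simp add: algebra_simps power2_eq_square)
          also have "\<dots> \<le> \<bar>p - Z \<omega>\<bar> * 1" using p elim by (intro mult_left_mono) auto
          also have "p - Z \<omega> = (mean t \<omega> - Z \<omega>) + (1 - \<alpha>) * D i t \<omega>"
            by (simp add: p_def draw_prob_def D_def algebra_simps)
          also have "\<bar>\<dots>\<bar> * 1 \<le> \<bar>mean t \<omega> - Z \<omega>\<bar> + \<bar>(1 - \<alpha>) * D i t \<omega>\<bar>" by simp
          also have "\<bar>(1 - \<alpha>) * D i t \<omega>\<bar> \<le> \<bar>D i t \<omega>\<bar>"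
            using alpha by (simp add: abs_mult mult_left_le_one_le)
          finally show ?thesis by (simp add: p_def)
        qed
        have eq: "noise_var (contrast j) t \<omega> - (1 - 1 / real N) * (Z \<omega> - (Z \<omega>)\<^sup>2)
            = (\<Sum>i=1..N. (contrast j i)\<^sup>2 * (draw_prob t i \<omega> * (1 - draw_prob t i \<omega>) - (Z \<omega> - (Z \<omega>)\<^sup>2)))"
          unfolding noise_var_def sum_contrast_square[OF j, symmetric] sum_distrib_right
          by (simp add: right_diff_distrib sum_subtractf)
        show ?case
          unfolding eq using close
          by (intro order_trans[OF sum_abs] sum_mono) (auto simp: abs_mult intro!: mult_left_mono)
      qed
    qed
    also have "\<dots> = B t"
      unfolding B_def using iZ imean D_int
      by (subst Bochner_Integration.integral_sum) (auto intro!: sum.cong)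
    finally show ?thesis .
  qed
  then show ?thesis
    by (intro tendsto_sandwich[OF always_eventually always_eventually tendsto_const B0]) auto
qed

text \<open>The common core of both regimes of \<open>\<alpha>\<close>, which differ only in the scaling \<open>s\<close> and the constant
  \<open>\<rho>\<close>. Divergence of \<open>s\<close> turns the boundedness of the scaled weights into the vanishing of the unscaled ones.\<close>

lemma scaled_deviation_converges_stably:
  assumes Z: "Z \<in> borel_measurable M" and lim: "AE \<omega> in M. (\<lambda>t. mean t \<omega>) \<longlonglongrightarrow> Z \<omega>"
    and j: "j \<in> {1..N}" and half: "1 / 2 \<le> \<alpha>" and \<rho>: "0 < \<rho>"
    and s: "filterlim s at_top sequentially"
    and s_lim: "(\<lambda>k. (m + real (Suc k))\<^sup>2
        * (1 / (s (Suc k))\<^sup>2 - (1 - \<alpha> / (m + real (Suc k)))\<^sup>2 / (s k)\<^sup>2)) \<longlonglongrightarrow> \<rho>"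
  shows "converges_stably M (\<lambda>t \<omega>. s t * (share t j \<omega> - mean t \<omega>))
    (gaussian_kernel (\<lambda>\<omega>. 1 / \<rho> * ((1 - 1 / real N) * (Z \<omega> - (Z \<omega>)\<^sup>2))))"
proof -
  note sc = scaled_weight_limits[OF half alpha(2) m_pos \<rho> s_lim]
  have w0: "(\<lambda>t. \<Sum>k<t. (weight \<alpha> m t k)\<^sup>2) \<longlonglongrightarrow> 0"
  proof -
    have "(\<lambda>t. (\<Sum>k<t. (s t * weight \<alpha> m t k)\<^sup>2) / (s t)\<^sup>2) \<longlonglongrightarrow> 0"
      using s by (intro tendsto_divide_0[OF sc(2)] filterlim_at_top_imp_at_infinity filterlim_pow_at_top) auto
    moreover have "\<forall>\<^sub>F t in sequentially. (\<Sum>k<t. (s t * weight \<alpha> m t k)\<^sup>2) / (s t)\<^sup>2 = (\<Sum>k<t. (weight \<alpha> m t k)\<^sup>2)"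
      using filterlim_at_top_dense[THEN iffD1, OF s, rule_format, of 0]
      by eventually_elim (simp add: power_mult_distrib flip: sum_distrib_left)
    ultimately show ?thesis by (rule Lim_transform_eventually)
  qed
  define V where "V \<omega> = (1 - 1 / real N) * (Z \<omega> - (Z \<omega>)\<^sup>2)" for \<omega>
  have vV: "(\<lambda>t. \<integral>\<omega>. \<bar>noise_var (contrast j) t \<omega> - V \<omega>\<bar> \<partial>M) \<longlonglongrightarrow> 0"
    unfolding V_def by (rule noise_var_contrast_tendsto[OF Z lim w0 j])
  have V: "integrable M V"
    unfolding V_def by (intro integrable_mult_right Bochner_Integration.integrable_diff integrable_limit[OF Z lim])
  have c: "\<bar>s t * weight \<alpha> m t k\<bar> \<le> \<bar>s t * decay \<alpha> m t\<bar> / m" for t k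
    using weight_bounds[OF alpha(2) m_pos, of t k] decay_pos[OF alpha(2) m_pos, of t] 
    by (simp add: abs_mult mult_left_mono flip: times_divide_eq_right)
  have e: "(\<lambda>t. \<bar>s t * decay \<alpha> m t\<bar> / m) \<longlonglongrightarrow> 0"
    using tendsto_divide[OF tendsto_rabs[OF sc(1)] tendsto_const[of m]] m_pos by simp
  have "converges_stably M (\<lambda>t \<omega>. \<Sum>k<t. s t * weight \<alpha> m t k * noise (contrast j) k \<omega>) (gaussian_kernel (\<lambda>\<omega>. 1 / \<rho> * V \<omega>))"
    by (rule stable_martingale_clt[OF bounded_mds_noise bounded_mds_noise_square vV V c e sc(2)])
  then show ?thesis
    unfolding V_def deviation_eq[OF j] sum_distrib_left mult.assoc .
qed

section \<open>Non-degeneracy of the limit\<close>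

lemma mean_Suc_noise:
  "mean (Suc t) \<omega> = mean t \<omega> + noise (\<lambda>_. 1 / real N) t \<omega> / (m + real (Suc t))"
proof -
  have "noise (\<lambda>_. 1 / real N) t \<omega> = ((\<Sum>i=1..N. I (Suc t) i \<omega>) - real N * mean t \<omega>) / real N"
    unfolding noise_def sum_distrib_left[symmetric] sum_subtractf sum_draw_prob by simp
  also have "\<dots> = (\<Sum>i=1..N. I (Suc t) i \<omega>) / real N - mean t \<omega>"
    using N_pos by (simp add: diff_divide_distrib)
  finally show ?thesis unfolding mean_Suc by simp
qed

text \<open>By convexity of the square, and since the drawing probabilities have the same mean as the
  proportions, the variance of the averaged draw is at most \<open>1 / N\<close> times
  \<open>mean * (1 - mean)\<close>.\<close>

lemma noise_var_uniform_le:
  assumes w: "\<omega> \<in> space M"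
  shows "noise_var (\<lambda>_. 1 / real N) t \<omega> \<le> mean t \<omega> * (1 - mean t \<omega>)"
proof -
  have "0 \<le> (\<Sum>i=1..N. (draw_prob t i \<omega> - mean t \<omega>)\<^sup>2)" by (intro sum_nonneg) simp
  also have "\<dots> = (\<Sum>i=1..N. (draw_prob t i \<omega>)\<^sup>2) - 2 * mean t \<omega> * (\<Sum>i=1..N. draw_prob t i \<omega>) + real N * (mean t \<omega>)\<^sup>2"
    by (simp add: power2_diff sum.distrib sum_subtractf sum_distrib_left mult_ac)
  also have "\<dots> = (\<Sum>i=1..N. (draw_prob t i \<omega>)\<^sup>2) - real N * (mean t \<omega>)\<^sup>2"
    unfolding sum_draw_prob by (simp add: power2_eq_square)
  finally have sq: "real N * (mean t \<omega>)\<^sup>2 \<le> (\<Sum>i=1..N. (draw_prob t i \<omega>)\<^sup>2)" by simp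
  have "noise_var (\<lambda>_. 1 / real N) t \<omega> = (1 / real N)\<^sup>2 * ((\<Sum>i=1..N. draw_prob t i \<omega>) - (\<Sum>i=1..N. (draw_prob t i \<omega>)\<^sup>2))"
    unfolding noise_var_def sum_distrib_left[symmetric]
    by (simp add: right_diff_distrib sum_subtractf power2_eq_square)
  also have "\<dots> \<le> (1 / real N)\<^sup>2 * (real N * mean t \<omega> - real N * (mean t \<omega>)\<^sup>2)"
    using sq unfolding sum_draw_prob by (intro mult_left_mono) auto
  also have "\<dots> = (1 / real N) * (mean t \<omega> * (1 - mean t \<omega>))"
    using N_pos by (simp add: power2_eq_square field_simps)
  also have "\<dots> \<le> 1 * (mean t \<omega> * (1 - mean t \<omega>))"
    using N_pos mean_01[OF w, of t] by (intro mult_right_mono) auto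
  finally show ?thesis by simp
qed

text \<open>The mean is a martingale with increments \<open>noise / n\<close>, where \<open>n = m + t + 1\<close>. One step therefore
  lowers the expectation by the variance of the noise divided by \<open>n\<^sup>2\<close>, that is at most by the
  factor \<open>1 - 1 / n\<^sup>2\<close>. The bound carries the exact value of the telescoping product
  of these factors.\<close>

lemma expectation_mean_times_one_minus_mean_ge:
  "real (a * b) / (m * (m + 1)) * ((m + real t + 1) / (m + real t)) \<le> (\<integral>\<omega>. mean t \<omega> * (1 - mean t \<omega>) \<partial>M)"
proof (induction t)
  case 0
  have "mean 0 \<omega> = real a / m" for \<omega> using N_pos by (simp add: urn_mean_def urn_prop_0)
  moreover have "real a / m * (1 - real a / m) = real (a * b) / (m * m)"
    using a_pos by (simp add: field_simps)
  ultimately show ?case using m_pos by (simp add: prob_space del: of_nat_add)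
next
  case (Suc t)
  define n where "n = m + real (Suc t)"
  define Y where "Y = noise (\<lambda>_. 1 / real N) t"
  define h where "h t = (\<integral>\<omega>. mean t \<omega> * (1 - mean t \<omega>) \<partial>M)" for t
  have n: "1 < n" using m_pos by (simp add: n_def)
  note [measurable] = measurable_F[OF mean_measurable] measurable_F[OF noise_measurable] measurable_F[OF noise_var_measurable]
  have mean1: "\<bar>mean t \<omega>\<bar> \<le> 1" "\<bar>mean t \<omega> * (1 - mean t \<omega>)\<bar> \<le> 1" "\<bar>1 - 2 * mean t \<omega>\<bar> \<le> 1" if "\<omega> \<in> space M" for \<omega>
    using mean_01[OF that, of t] by (auto simp: abs_mult intro: mult_le_one)
  have Y1: "\<bar>Y \<omega>\<bar> \<le> 1" if "\<omega> \<in> space M" for \<omega>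
    using abs_noise_le[OF that, of "\<lambda>_. 1 / real N" t] N_pos by (simp add: Y_def)
  have iY: "integrable M (\<lambda>\<omega>. (1 - 2 * mean t \<omega>) * Y \<omega>)"
    using mean1 Y1 by (intro integrable_mult_bounded[where B=1 and C=1]) (auto simp: Y_def)
  have iY2: "integrable M (\<lambda>\<omega>. (Y \<omega>)\<^sup>2)"
    using power_mono[OF Y1, where n=2] by (intro integrable_bounded[where B=1]) (auto simp: Y_def)
  have ih: "integrable M (\<lambda>\<omega>. mean t \<omega> * (1 - mean t \<omega>))"
    using mean1(2) by (intro integrable_bounded[where B=1]) auto
  have iv: "integrable M (noise_var (\<lambda>_. 1 / real N) t)"
    using noise_var_bounds[of _ "\<lambda>_. 1 / real N" t]
    by (intro integrable_bounded[where B="\<Sum>i=1..N. (1 / real N)\<^sup>2"]) auto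
  have "h (Suc t) = (\<integral>\<omega>. mean t \<omega> * (1 - mean t \<omega>) + (1 / n) * ((1 - 2 * mean t \<omega>) * Y \<omega>) - (1 / n\<^sup>2) * (Y \<omega>)\<^sup>2 \<partial>M)"
    unfolding h_def mean_Suc_noise Y_def[symmetric] n_def[symmetric] using n
    by (intro Bochner_Integration.integral_cong refl) (simp add: field_simps power2_eq_square)
  also have "\<dots> = h t + (1 / n) * (\<integral>\<omega>. (1 - 2 * mean t \<omega>) * Y \<omega> \<partial>M) - (1 / n\<^sup>2) * (\<integral>\<omega>. (Y \<omega>)\<^sup>2 \<partial>M)"
    using ih iY iY2 by (simp add: h_def)
  also have "(\<integral>\<omega>. (1 - 2 * mean t \<omega>) * Y \<omega> \<partial>M) = 0"
    unfolding Y_def using mean1(3)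
    by (intro expectation_mult_noise(1)[where B=1] borel_measurable_diff borel_measurable_times borel_measurable_const mean_measurable)
  also have "(\<integral>\<omega>. (Y \<omega>)\<^sup>2 \<partial>M) = (\<integral>\<omega>. noise_var (\<lambda>_. 1 / real N) t \<omega> \<partial>M)"
    using expectation_mult_noise(2)[of "\<lambda>_. 1" t 1] by (simp add: Y_def)
  finally have eq: "h (Suc t) = h t - (1 / n\<^sup>2) * (\<integral>\<omega>. noise_var (\<lambda>_. 1 / real N) t \<omega> \<partial>M)" by simp
  have "(\<integral>\<omega>. noise_var (\<lambda>_. 1 / real N) t \<omega> \<partial>M) \<le> h t"
    unfolding h_def by (intro integral_mono iv ih noise_var_uniform_le)
  then have "(1 / n\<^sup>2) * (\<integral>\<omega>. noise_var (\<lambda>_. 1 / real N) t \<omega> \<partial>M) \<le> (1 / n\<^sup>2) * h t"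
    by (rule mult_left_mono) simp
  then have step: "h t * (1 - 1 / n\<^sup>2) \<le> h (Suc t)" unfolding eq by (simp add: algebra_simps)
  have "real (a * b) / (m * (m + 1)) * ((n + 1) / n) = real (a * b) / (m * (m + 1)) * (n / (n - 1)) * (1 - 1 / n\<^sup>2)"
  proof -
    have "(n + 1) / n = n / (n - 1) * (1 - 1 / n\<^sup>2)"
      using n by (simp add: field_simps power2_eq_square)
    then show ?thesis by simp
  qed
  also have "\<dots> \<le> h t * (1 - 1 / n\<^sup>2)"
    using Suc.IH n by (intro mult_right_mono) (auto simp: h_def n_def add_ac)
  finally show ?case using step by (simp add: h_def n_def add_ac)
qed

text \<open>The lower bound on the expectation of \<open>mean * (1 - mean)\<close> is positive uniformly in time, and it
  passes to the limit by dominated convergence.\<close>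

lemma limit_nondegenerate:
  assumes Z[measurable]: "Z \<in> borel_measurable M" and lim: "AE \<omega> in M. (\<lambda>t. mean t \<omega>) \<longlonglongrightarrow> Z \<omega>"
    and c: "c \<noteq> (0::real)"
  shows "\<not> (AE \<omega> in M. c * (Z \<omega> - (Z \<omega>)\<^sup>2) = 0)"
proof
  assume "AE \<omega> in M. c * (Z \<omega> - (Z \<omega>)\<^sup>2) = 0"
  then have "AE \<omega> in M. Z \<omega> * (1 - Z \<omega>) = 0"
    using c by (auto simp: right_diff_distrib power2_eq_square)
  then have "(\<integral>\<omega>. Z \<omega> * (1 - Z \<omega>) \<partial>M) = (\<integral>\<omega>. 0 \<partial>M)" by (intro integral_cong_AE) auto
  moreover
  note [measurable] = measurable_F[OF mean_measurable]
  have "(\<lambda>t. \<integral>\<omega>. mean t \<omega> * (1 - mean t \<omega>) \<partial>M) \<longlonglongrightarrow> (\<integral>\<omega>. Z \<omega> * (1 - Z \<omega>) \<partial>M)"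
  proof (rule integral_dominated_convergence[where w="\<lambda>_. 1"])
    show "AE \<omega> in M. (\<lambda>t. mean t \<omega> * (1 - mean t \<omega>)) \<longlonglongrightarrow> Z \<omega> * (1 - Z \<omega>)"
      using lim by eventually_elim (intro tendsto_intros)
    show "AE \<omega> in M. norm (mean t \<omega> * (1 - mean t \<omega>)) \<le> 1" for t
      using mean_01[of _ t] by (intro AE_I2) (auto simp: abs_mult intro: mult_le_one)
  qed simp_all
  moreover have "real (a * b) / (m * (m + 1)) \<le> (\<integral>\<omega>. mean t \<omega> * (1 - mean t \<omega>) \<partial>M)" for t
  proof -
    have "1 \<le> (m + real t + 1) / (m + real t)" using m_pos by simp
    then have "real (a * b) / (m * (m + 1)) * 1 \<le> real (a * b) / (m * (m + 1)) * ((m + real t + 1) / (m + real t))"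
      using m_pos by (intro mult_left_mono) auto
    with expectation_mean_times_one_minus_mean_ge[of t] show ?thesis by simp
  qed
  ultimately have "real (a * b) / (m * (m + 1)) \<le> 0"
    by (auto intro: LIMSEQ_le_const)
  moreover have "0 < real (a * b) / (m * (m + 1))" using a_pos b_pos by simp
  ultimately show False by simp
qed

end

section \<open>Stable convergence of the scaled deviation\<close>

theorem theorem3p3:
  fixes M :: "'a measure" and N a b j :: nat and \<alpha> :: real
    and I :: "nat \<Rightarrow> nat \<Rightarrow> 'a \<Rightarrow> real" and Z :: "'a \<Rightarrow> real"
  assumes "interacting_urns M N a b \<alpha> I"
    and "N > 1" and "a \<ge> 1" and "b \<ge> 1"
    and "Z \<in> borel_measurable M"
    and "AE \<omega> in M. (\<lambda>t. urn_mean N a b I t \<omega>) \<longlonglongrightarrow> Z \<omega>"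
    and "j \<in> {1..N}"
  shows
    "(1 / 2 < \<alpha> \<and> \<alpha> \<le> 1 \<longrightarrow>
        converges_stably M
          (\<lambda>t \<omega>. sqrt (real t) * (urn_prop a b I t j \<omega> - urn_mean N a b I t \<omega>))
          (gaussian_kernel (\<lambda>\<omega>. (1 - 1 / real N) / (2 * \<alpha> - 1) * (Z \<omega> - (Z \<omega>)\<^sup>2))) \<and>
        \<not> (AE \<omega> in M. (1 - 1 / real N) / (2 * \<alpha> - 1) * (Z \<omega> - (Z \<omega>)\<^sup>2) = 0)) \<and>
     (\<alpha> = 1 / 2 \<longrightarrow>
        converges_stably M
          (\<lambda>t \<omega>. sqrt (real t) / sqrt (ln (real t))
                   * (urn_prop a b I t j \<omega> - urn_mean N a b I t \<omega>))
          (gaussian_kernel (\<lambda>\<omega>. (1 - 1 / real N) * (Z \<omega> - (Z \<omega>)\<^sup>2))) \<and>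
        \<not> (AE \<omega> in M. (1 - 1 / real N) * (Z \<omega> - (Z \<omega>)\<^sup>2) = 0))"
proof -
  interpret interacting_urns M N a b \<alpha> I by fact
  interpret nonempty_urns M N a b \<alpha> I
    using assms(2-4) by unfold_locales auto
  note Z = assms(5,6) and j = assms(7)
  have N: "1 - 1 / real N \<noteq> 0" using \<open>N > 1\<close> by simp
  show ?thesis
  proof (intro conjI impI)
    assume \<alpha>: "1 / 2 < \<alpha> \<and> \<alpha> \<le> 1"
    have "filterlim (\<lambda>t. sqrt (real t)) at_top sequentially" by real_asymp
    from scaled_deviation_converges_stably[OF Z j _ _ this sqrt_scaling_limit] \<alpha>
    show "converges_stably M (\<lambda>t \<omega>. sqrt (real t) * (share t j \<omega> - mean t \<omega>))
        (gaussian_kernel (\<lambda>\<omega>. (1 - 1 / real N) / (2 * \<alpha> - 1) * (Z \<omega> - (Z \<omega>)\<^sup>2)))"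
      by simp
    show "\<not> (AE \<omega> in M. (1 - 1 / real N) / (2 * \<alpha> - 1) * (Z \<omega> - (Z \<omega>)\<^sup>2) = 0)"
      using \<alpha> N by (intro limit_nondegenerate[OF Z]) auto
  next
    assume \<alpha>: "\<alpha> = 1 / 2"
    have "filterlim (\<lambda>t. sqrt (real t) / sqrt (ln (real t))) at_top sequentially" by real_asymp
    from scaled_deviation_converges_stably[OF Z j _ _ this sqrt_log_scaling_limit[of m, folded \<alpha>]] \<alpha>
    show "converges_stably M (\<lambda>t \<omega>. sqrt (real t) / sqrt (ln (real t)) * (share t j \<omega> - mean t \<omega>))
        (gaussian_kernel (\<lambda>\<omega>. (1 - 1 / real N) * (Z \<omega> - (Z \<omega>)\<^sup>2)))"
      by simp
    show "\<not> (AE \<omega> in M. (1 - 1 / real N) * (Z \<omega> - (Z \<omega>)\<^sup>2) = 0)"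
      by (rule limit_nondegenerate[OF Z N])
  qed
qed

end
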